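(* Let $\star$ be a semistar operation on an integral domain $D$ and let $D$ be a P$\star$MD. (1) Let $P\in\mathrm{QSpec}^{\star_f}(D)$. Then $P$ is $\star_f$-sharp in $D$ if and only if $P\,\mathrm{Na}(D,\star)$ is sharp in the Prüfer domain $\mathrm{Na}(D,\star)$. (2) $D$ is $\star_f$-sharp if and only if $\mathrm{Na}(D,\star)$ is sharp. (3) $D$ is $\star_f$-doublesharp if and only if $\mathrm{Na}(D,\star)$ is doublesharp.
   Context: Let $D$ be an integral domain with quotient field $K$. Denote by $\overline{\boldsymbol F}(D)$ the set of nonzero $D$-submodules of $K$ and by $\boldsymbol f(D)$ the set of nonzero finitely generated $D$-submodules of $K$. A semistar operation on $D$ is a map $\star:\overline{\boldsymbol F}(D)\to\overline{\boldsymbol F}(D)$, $E\mapsto E^\star$, such that for all $0\ne x\in K$ and $E,F\in\overline{\boldsymbol F}(D)$: $(xE)^\star=xE^\star$; $E\subseteq F$ implies $E^\star\subseteq F^\star$; $E\subseteq E^\star$ and $(E^\star)^\star=E^\star$. The associated finite-type operation is $E^{\star_f}:=\bigcup\{F^\star\mid F\in\boldsymbol f(D),\,F\subseteq E\}$. P$\star$MD: $D$ is a P$\star$MD if $(FF^{-1})^{\star_f}=D^{\star}$ for every $F\in\boldsymbol f(D)$, where $F^{-1}=(D:_KF)$. A nonzero ideal $I$ of $D$ is a quasi-$\star$-ideal if $I^\star\cap D=I$. $\mathrm{QSpec}^{\star}(D)$ is the set of prime quasi-$\star$-ideals, and $\mathrm{QMax}^{\star}(D)$ the set of ideals maximal among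 the proper quasi-$\star$-ideals. Semistar sharpness: for $P\in\mathrm{QSpec}^{\star_f}(D)$ put $\nabla^{\star_f}(P):=\{M\in\mathrm{QMax}^{\star_f}(D)\mid M\nsupseteq P\}$ and $\Theta^{\star_f}(P):=\bigcap\{D_M\mid M\in\nabla^{\star_f}(P)\}$ (an empty intersection is $K$). $P$ is $\star_f$-sharp if $\Theta^{\star_f}(P)\nsubseteq D_P$. $D$ is $\star_f$-sharp if every $M\in\mathrm{QMax}^{\star_f}(D)$ is $\star_f$-sharp, and $\star_f$-doublesharp if every $P\in\mathrm{QSpec}^{\star_f}(D)$ is $\star_f$-sharp. Sharpness: a prime $Q$ of a domain $A$ is sharp if $\bigcap\{A_M\mid M\in\mathrm{Max}(A),\ M\nsupseteq Q\}\nsubseteq A_Q$ (an empty intersection is the quotient field of $A$). $A$ is sharp (respectively doublesharp) if every nonzero maximal (respectively nonzero prime) ideal of $A$ is sharp; this is the case of the identity semistar operation in the previous definitions. Nagata ring: for a polynomial $g$, $\boldsymbol c(g)$ denotes its content, i.e. the ideal generated by its coefficients. With $X$ an indeterminate, $\mathrm{Na}(D,\star):=\{f/g\mid f,g\in D[X],\ g\neq0,\ \boldsymbol c(g)^\star=D^\star\}$. When $D$ is a P$\star$MD, $\mathrm{Na}(D,\star)$ is a Prüfer domain and $P\,\mathrm{Na}(D,\star)$ is a prime ideal of it for each $P\in\mathrm{QSpec}^{\star_f}(D)$. *)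

theory Defs
  imports
    "HOL-Algebra.Module"
    "HOL-Algebra.Ideal"
    "HOL-Algebra.Subrings"
    "HOL-Computational_Algebra.Polynomial"
    "HOL-Computational_Algebra.Fraction_Field"
begin

text \<open>
  The quotient field is a type of class \<open>field\<close> and a domain is a subset of that type.
  \<open>ring_on A\<close> views such a subset as a ring of HOL-Algebra, so that ideals, prime ideals,
  maximal ideals and submodules are those of HOL-Algebra.
\<close>

definition ring_on :: "'k::field set \<Rightarrow> 'k ring" where
  "ring_on A = \<lparr>carrier = A, monoid.mult = (*), one = 1, ring.zero = 0, add = (+)\<rparr>"

definition field_module :: "('k::field, 'k) module" where
  "field_module = \<lparr>carrier = UNIV, monoid.mult = (*), one = 1, ring.zero = 0, add = (+), module.smult = (*)\<rparr>"

definition quotient_field :: "'k::field set \<Rightarrow> 'k set" where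
  "quotient_field A = {a / b | a b. a \<in> A \<and> b \<in> A \<and> b \<noteq> 0}"

definition domain_with_quotient_field :: "'k::field set \<Rightarrow> bool" where
  "domain_with_quotient_field D \<longleftrightarrow> subdomain D (ring_on UNIV) \<and> quotient_field D = UNIV"

definition localization :: "'k::field set \<Rightarrow> 'k set \<Rightarrow> 'k set" where
  "localization A Q = {a / s | a s. a \<in> A \<and> s \<in> A - Q}"


subsection \<open>Semistar operations\<close>

definition is_submodule :: "'k::field set \<Rightarrow> 'k set \<Rightarrow> bool" where
  "is_submodule D E \<longleftrightarrow> submodule E (ring_on D) field_module"

definition Fbar :: "'k::field set \<Rightarrow> 'k set set" where
  "Fbar D = {E. is_submodule D E \<and> E \<noteq> {0}}"

definition fg :: "'k::field set \<Rightarrow> 'k set set" where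
  "fg D = {E \<in> Fbar D. \<exists>S. finite S \<and> E = is_submodule D hull S}"

text \<open>The values of \<open>star\<close> outside \<open>Fbar D\<close> are irrelevant.\<close>

definition semistar_operation :: "'k::field set \<Rightarrow> ('k set \<Rightarrow> 'k set) \<Rightarrow> bool" where
  "semistar_operation D star \<longleftrightarrow>
     (\<forall>E\<in>Fbar D. star E \<in> Fbar D) \<and>
     (\<forall>x. \<forall>E\<in>Fbar D. x \<noteq> 0 \<longrightarrow> star ((*) x ` E) = (*) x ` star E) \<and>
     (\<forall>E\<in>Fbar D. \<forall>F\<in>Fbar D. E \<subseteq> F \<longrightarrow> star E \<subseteq> star F) \<and>
     (\<forall>E\<in>Fbar D. E \<subseteq> star E \<and> star (star E) = star E)"

definition finite_type :: "'k::field set \<Rightarrow> ('k set \<Rightarrow> 'k set) \<Rightarrow> 'k set \<Rightarrow> 'k set" where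
  "finite_type D star E = \<Union>{star F | F. F \<in> fg D \<and> F \<subseteq> E}"

definition module_prod :: "'k::field set \<Rightarrow> 'k set \<Rightarrow> 'k set \<Rightarrow> 'k set" where
  "module_prod D E F = is_submodule D hull {x * y | x y. x \<in> E \<and> y \<in> F}"

definition module_inv :: "'k::field set \<Rightarrow> 'k set \<Rightarrow> 'k set" where
  "module_inv D F = {x. \<forall>y\<in>F. x * y \<in> D}"

definition PstarMD :: "'k::field set \<Rightarrow> ('k set \<Rightarrow> 'k set) \<Rightarrow> bool" where
  "PstarMD D star \<longleftrightarrow>
     (\<forall>F\<in>fg D. finite_type D star (module_prod D F (module_inv D F)) = star D)"

definition quasi_star_ideal :: "'k::field set \<Rightarrow> ('k set \<Rightarrow> 'k set) \<Rightarrow> 'k set \<Rightarrow> bool" where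
  "quasi_star_ideal D star I \<longleftrightarrow> ideal I (ring_on D) \<and> I \<noteq> {0} \<and> star I \<inter> D = I"

definition QSpec :: "'k::field set \<Rightarrow> ('k set \<Rightarrow> 'k set) \<Rightarrow> 'k set set" where
  "QSpec D star = {P. quasi_star_ideal D star P \<and> primeideal P (ring_on D)}"

definition QMax :: "'k::field set \<Rightarrow> ('k set \<Rightarrow> 'k set) \<Rightarrow> 'k set set" where
  "QMax D star = {M. quasi_star_ideal D star M \<and> M \<noteq> D \<and>
     (\<forall>I. quasi_star_ideal D star I \<and> I \<noteq> D \<and> M \<subseteq> I \<longrightarrow> I = M)}"


subsection \<open>Sharpness\<close>

text \<open>
  The sharpness notions below take an arbitrary operation \<open>star\<close>; to obtain those attached
  to the finite-type operation, use them with \<open>finite_type D star\<close>. Intersecting with the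
  quotient field makes an empty intersection equal to that field.
\<close>

definition nabla :: "'k::field set \<Rightarrow> ('k set \<Rightarrow> 'k set) \<Rightarrow> 'k set \<Rightarrow> 'k set set" where
  "nabla D star P = {M \<in> QMax D star. \<not> P \<subseteq> M}"

definition Theta :: "'k::field set \<Rightarrow> ('k set \<Rightarrow> 'k set) \<Rightarrow> 'k set \<Rightarrow> 'k set" where
  "Theta D star P = quotient_field D \<inter> \<Inter>{localization D M | M. M \<in> nabla D star P}"

definition star_sharp_prime :: "'k::field set \<Rightarrow> ('k set \<Rightarrow> 'k set) \<Rightarrow> 'k set \<Rightarrow> bool" where
  "star_sharp_prime D star P \<longleftrightarrow> \<not> Theta D star P \<subseteq> localization D P"

definition star_sharp :: "'k::field set \<Rightarrow> ('k set \<Rightarrow> 'k set) \<Rightarrow> bool" where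
  "star_sharp D star \<longleftrightarrow> (\<forall>M\<in>QMax D star. star_sharp_prime D star M)"

definition star_doublesharp :: "'k::field set \<Rightarrow> ('k set \<Rightarrow> 'k set) \<Rightarrow> bool" where
  "star_doublesharp D star \<longleftrightarrow> (\<forall>P\<in>QSpec D star. star_sharp_prime D star P)"

definition sharp_prime :: "'k::field set \<Rightarrow> 'k set \<Rightarrow> bool" where
  "sharp_prime A Q \<longleftrightarrow>
     \<not> quotient_field A \<inter> \<Inter>{localization A M | M. maximalideal M (ring_on A) \<and> \<not> Q \<subseteq> M}
         \<subseteq> localization A Q"

definition sharp :: "'k::field set \<Rightarrow> bool" where
  "sharp A \<longleftrightarrow> (\<forall>M. maximalideal M (ring_on A) \<and> M \<noteq> {0} \<longrightarrow> sharp_prime A M)"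

definition doublesharp :: "'k::field set \<Rightarrow> bool" where
  "doublesharp A \<longleftrightarrow> (\<forall>Q. primeideal Q (ring_on A) \<and> Q \<noteq> {0} \<longrightarrow> sharp_prime A Q)"


subsection \<open>The Nagata ring\<close>

definition polys_over :: "'k::field set \<Rightarrow> 'k poly set" where
  "polys_over D = {f. \<forall>n. coeff f n \<in> D}"

definition content_ideal :: "'k::field set \<Rightarrow> 'k poly \<Rightarrow> 'k set" where
  "content_ideal D g = Idl\<^bsub>ring_on D\<^esub> (range (coeff g))"

definition Na :: "'k::field set \<Rightarrow> ('k set \<Rightarrow> 'k set) \<Rightarrow> 'k poly fract set" where
  "Na D star = {Fraction_Field.Fract f g | f g.
     f \<in> polys_over D \<and> g \<in> polys_over D \<and> g \<noteq> 0 \<and> star (content_ideal D g) = star D}"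

text \<open>The extended ideal \<open>P Na(D, star)\<close>, with \<open>P\<close> embedded as constants.\<close>

definition Na_extension :: "'k::field set \<Rightarrow> ('k set \<Rightarrow> 'k set) \<Rightarrow> 'k set \<Rightarrow> 'k poly fract set" where
  "Na_extension D star P = Idl\<^bsub>ring_on (Na D star)\<^esub> ((\<lambda>p. Fraction_Field.Fract [:p:] 1) ` P)"

end

(*
  Write s for the finite-type operation, P[X] for the polynomials with coefficients in P, and
  ext P for the fractions f / g with f in P[X] and g a denominator of Na(D, star). A nonzero
  polynomial over D is such a denominator iff it lies in no M[X] with M a maximal quasi-s-ideal,
  and an ideal of D[X] without denominators lies in a single M[X]; so the nonzero maximal ideals
  of Na(D, star) are the ext M.

  In a PstarMD a nonzero polynomial p over K has, for each prime quasi-s-ideal P, a multiple z p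
  with coefficients in D, not all of them in P. This one normalization replaces the valuations
  belonging to the rings D_P. Applied to f in a prime Q contained in ext M, it puts all coefficients
  of f into Q, so every nonzero prime of Na(D, star) is some ext P. Applied to the denominator of an
  element f / g outside the localization at ext P, it yields a coefficient of z f outside D_P; by
  Gauss' lemma that coefficient lies in D_M whenever f / g lies in the localization at ext M.
  Sharpness thus passes from Na(D, star) to D. The other direction holds because an element of K
  lies in the localization at ext P iff it lies in D_P.
*)

theory Submission
  imports Defs
begin

section \<open>Ideals, prime ideals, maximal ideals and submodules in elementwise terms\<close>

subsection \<open>Subrings of a field\<close>

lemma ring_on_simps [simp]:
  "carrier (ring_on A) = A"
  "x \<otimes>\<^bsub>ring_on A\<^esub> y = x * y"
  "\<one>\<^bsub>ring_on A\<^esub> = 1"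
  "x \<oplus>\<^bsub>ring_on A\<^esub> y = x + y"
  "\<zero>\<^bsub>ring_on A\<^esub> = 0"
  by (simp_all add: ring_on_def)

text \<open>The group inverse is a definite description over the carrier, so it yields the negative
  of the field once \<open>- x\<close> is known to lie in \<open>A\<close>.\<close>

lemma inv_add_ring_on:
  fixes x :: "'k::field"
  assumes "x \<in> A" "- x \<in> A"
  shows "inv\<^bsub>add_monoid (ring_on A)\<^esub> x = - x"
  unfolding m_inv_def
  using assms by (intro the_equality) (auto dest: minus_unique)

text \<open>Stated for an arbitrary subset of a field because it serves twice: for \<open>D\<close>
  inside K, and for the Nagata ring inside the field of fractions of polynomials.\<close>

locale field_subring =
  fixes A :: "'k::field set"
  assumes one_mem [simp]: "1 \<in> A"
    and add_mem: "x \<in> A \<Longrightarrow> y \<in> A \<Longrightarrow> x + y \<in> A"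
    and uminus_mem: "x \<in> A \<Longrightarrow> - x \<in> A"
    and mult_mem: "x \<in> A \<Longrightarrow> y \<in> A \<Longrightarrow> x * y \<in> A"
begin

lemma zero_mem [simp]: "0 \<in> A"
  using add_mem[OF one_mem uminus_mem[OF one_mem]] by simp

lemma cring_ring_on: "cring (ring_on A)"
proof (rule cringI)
  show "abelian_group (ring_on A)"
  proof (rule abelian_groupI)
    fix x assume "x \<in> carrier (ring_on A)"
    then show "\<exists>y\<in>carrier (ring_on A). y \<oplus>\<^bsub>ring_on A\<^esub> x = \<zero>\<^bsub>ring_on A\<^esub>"
      by (intro bexI[of _ "- x"]) (auto simp: uminus_mem)
  qed (auto simp: add_mem algebra_simps)
  show "Group.comm_monoid (ring_on A)"
    by (rule Group.comm_monoidI) (auto simp: mult_mem)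
qed (auto simp: algebra_simps)

lemma ring_ring_on: "ring (ring_on A)"
  using cring_ring_on by (rule cring.axioms)

text \<open>Negatives need no separate closure condition: multiplication by \<open>- 1\<close>,
  which lies in \<open>A\<close>, supplies them.\<close>

lemma ideal_iff:
  "ideal I (ring_on A) \<longleftrightarrow>
     I \<subseteq> A \<and> 0 \<in> I \<and> (\<forall>x\<in>I. \<forall>y\<in>I. x + y \<in> I) \<and> (\<forall>a\<in>A. \<forall>x\<in>I. a * x \<in> I)"
  (is "?L \<longleftrightarrow> ?R")
proof
  assume ?L
  then interpret ideal I "ring_on A" .
  show ?R
    using a_subset I_l_closed additive_subgroup.zero_closed[OF is_additive_subgroup]
      additive_subgroup.a_closed[OF is_additive_subgroup]
    by auto
next
  assume R: ?R
  have neg: "- x \<in> I" if "x \<in> I" for x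
    using R uminus_mem[OF one_mem] that by force
  show ?L
  proof (rule idealI[OF ring_ring_on])
    show "subgroup I (add_monoid (ring_on A))"
    proof (rule subgroup.intro)
      fix x assume "x \<in> I"
      then show "inv\<^bsub>add_monoid (ring_on A)\<^esub> x \<in> I"
        using R neg by (subst inv_add_ring_on) (auto simp: uminus_mem)
    qed (use R in auto)
  next
    fix a x assume "a \<in> I" "x \<in> carrier (ring_on A)"
    then have "x * a \<in> I" using R by simp
    then show "x \<otimes>\<^bsub>ring_on A\<^esub> a \<in> I" "a \<otimes>\<^bsub>ring_on A\<^esub> x \<in> I"
      by (simp_all add: mult.commute[of a x])
  qed
qed

lemma primeideal_iff:
  "primeideal P (ring_on A) \<longleftrightarrow>
     ideal P (ring_on A) \<and> P \<noteq> A \<and> (\<forall>a\<in>A. \<forall>b\<in>A. a * b \<in> P \<longrightarrow> a \<in> P \<or> b \<in> P)"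
proof
  assume "primeideal P (ring_on A)"
  then interpret primeideal P "ring_on A" .
  show "ideal P (ring_on A) \<and> P \<noteq> A \<and> (\<forall>a\<in>A. \<forall>b\<in>A. a * b \<in> P \<longrightarrow> a \<in> P \<or> b \<in> P)"
    using I_notcarr I_prime ideal_axioms by auto
next
  assume "ideal P (ring_on A) \<and> P \<noteq> A \<and> (\<forall>a\<in>A. \<forall>b\<in>A. a * b \<in> P \<longrightarrow> a \<in> P \<or> b \<in> P)"
  then show "primeideal P (ring_on A)"
    by (intro primeidealI cring_ring_on) auto
qed

lemma maximalideal_iff:
  "maximalideal M (ring_on A) \<longleftrightarrow>
     ideal M (ring_on A) \<and> M \<noteq> A \<and> (\<forall>J. ideal J (ring_on A) \<and> M \<subseteq> J \<and> J \<noteq> A \<longrightarrow> J = M)"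
proof
  assume "maximalideal M (ring_on A)"
  then interpret maximalideal M "ring_on A" .
  show "ideal M (ring_on A) \<and> M \<noteq> A \<and> (\<forall>J. ideal J (ring_on A) \<and> M \<subseteq> J \<and> J \<noteq> A \<longrightarrow> J = M)"
    using I_notcarr I_maximal ideal_axioms by (metis ideal_iff ring_on_simps(1))
next
  assume "ideal M (ring_on A) \<and> M \<noteq> A \<and> (\<forall>J. ideal J (ring_on A) \<and> M \<subseteq> J \<and> J \<noteq> A \<longrightarrow> J = M)"
  then show "maximalideal M (ring_on A)"
    by (intro maximalidealI) auto
qed

lemma proper_ideal_iff: "ideal I (ring_on A) \<Longrightarrow> I \<noteq> A \<longleftrightarrow> 1 \<notin> I"
  by (auto simp: ideal_iff) (metis mult.right_neutral subsetD)+

end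

lemma submodule_iff:
  fixes D :: "'k::field set"
  assumes "field_subring D"
  shows "is_submodule D E \<longleftrightarrow>
    0 \<in> E \<and> (\<forall>x\<in>E. \<forall>y\<in>E. x + y \<in> E) \<and> (\<forall>a\<in>D. \<forall>x\<in>E. a * x \<in> E)"
  (is "?L \<longleftrightarrow> ?R")
proof
  assume ?L
  then interpret submodule E "ring_on D" field_module
    by (simp add: is_submodule_def)
  show ?R
    using smult_closed m_closed one_closed by (auto simp: field_module_def)
next
  interpret field_subring D by fact
  have inv: "inv\<^bsub>add_monoid (field_module :: ('k, 'k) module)\<^esub> x = - x" for x
    unfolding m_inv_def
    by (rule the_equality) (auto simp: field_module_def dest: minus_unique)
  assume R: ?R
  have neg: "- x \<in> E" if "x \<in> E" for x
    using R uminus_mem[OF one_mem] that by force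
  show ?L
    unfolding is_submodule_def
  proof (intro submodule.intro subgroup.intro)
    fix x assume "x \<in> E"
    then show "inv\<^bsub>add_monoid field_module\<^esub> x \<in> E"
      using neg by (simp add: inv)
  next
    show "submodule_axioms E (ring_on D) field_module"
      using R by unfold_locales (auto simp: field_module_def)
  qed (use R in \<open>auto simp: field_module_def\<close>)
qed

lemma field_subring_of_subdomain:
  fixes D :: "'k::field set"
  assumes "domain_with_quotient_field D"
  shows "field_subring D"
proof -
  interpret subdomain D "ring_on UNIV :: 'k ring"
    using assms by (simp add: domain_with_quotient_field_def)
  show ?thesis
  proof
    show "1 \<in> D" using submonoid.one_closed[OF submonoid_axioms] by simp
    show "x * y \<in> D" if "x \<in> D" "y \<in> D" for x y
      using submonoid.m_closed[OF submonoid_axioms] that by simp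
    show "x + y \<in> D" if "x \<in> D" "y \<in> D" for x y
      using subgroup.m_closed[OF subgroup_axioms] that by simp
    show "- x \<in> D" if "x \<in> D" for x
      using subgroup.m_inv_closed[OF subgroup_axioms that] inv_add_ring_on[of x UNIV] by simp
  qed
qed


section \<open>Polynomials as containers for finite sets of coefficients\<close>

subsection \<open>Contents of polynomials\<close>

text \<open>The shift by one more than the degree prevents any overlap, so the coefficients of
  \<open>q\<close> simply follow those of \<open>p\<close>. The content of the result is thus the
  sum of the two contents, with no cancellation.\<close>

definition glue :: "'k::field poly \<Rightarrow> 'k poly \<Rightarrow> 'k poly" where
  "glue p q = p + monom 1 (Suc (degree p)) * q"

lemma coeff_glue:
  "coeff (glue p q) n = (if n \<le> degree p then coeff p n else coeff q (n - Suc (degree p)))"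
  by (auto simp: glue_def coeff_monom_mult coeff_eq_0)

lemma range_coeff_glue: "range (coeff (glue p q)) = range (coeff p) \<union> range (coeff q)"
proof
  show "range (coeff (glue p q)) \<subseteq> range (coeff p) \<union> range (coeff q)"
    by (auto simp: coeff_glue)
  have q: "coeff q n \<in> range (coeff (glue p q))" for n
  proof
    show "coeff q n = coeff (glue p q) (n + Suc (degree p))"
      by (simp add: coeff_glue)
  qed simp
  have "coeff p n \<in> range (coeff (glue p q))" for n
  proof (cases "n \<le> degree p")
    case True
    show ?thesis by (rule range_eqI[of _ _ n]) (simp add: coeff_glue True)
  next
    case False
    \<comment> \<open>Beyond its degree \<open>p\<close> has coefficient 0, which also occurs as a
      coefficient of \<open>q\<close> just past the degree of \<open>q\<close>.\<close>
    then show ?thesis using q[of "Suc (degree q)"] by (simp add: coeff_eq_0)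
  qed
  with q show "range (coeff p) \<union> range (coeff q) \<subseteq> range (coeff (glue p q))"
    by blast
qed

lemma glue_neq_0: "p \<noteq> 0 \<or> q \<noteq> 0 \<Longrightarrow> glue p q \<noteq> 0"
proof (rule notI)
  assume "p \<noteq> 0 \<or> q \<noteq> 0" "glue p q = 0"
  then have "range (coeff p) \<union> range (coeff q) = {0}"
    using range_coeff_glue[of p q] by auto
  then have "coeff p n = 0" "coeff q n = 0" for n by blast+
  then have "p = 0" "q = 0" by (auto intro: poly_eqI)
  with \<open>p \<noteq> 0 \<or> q \<noteq> 0\<close> show False by blast
qed

lemma mem_polys_over: "f \<in> polys_over A \<longleftrightarrow> range (coeff f) \<subseteq> A"
  by (auto simp: polys_over_def)

lemma polys_over_coeff: "f \<in> polys_over A \<Longrightarrow> coeff f n \<in> A"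
  by (simp add: polys_over_def)

lemma polys_over_mono: "A \<subseteq> B \<Longrightarrow> polys_over A \<subseteq> polys_over B"
  by (auto simp: polys_over_def)

lemma polys_over_glue: "glue p q \<in> polys_over A \<longleftrightarrow> p \<in> polys_over A \<and> q \<in> polys_over A"
  by (simp add: mem_polys_over range_coeff_glue)

section \<open>Finitely generated \<open>D\<close>-modules as contents of polynomials over K\<close>

locale semistar_domain =
  fixes D :: "'k::field set" and star :: "'k set \<Rightarrow> 'k set"
  assumes domain_D: "domain_with_quotient_field D"
    and semistar: "semistar_operation D star"
begin

sublocale field_subring D
  by (rule field_subring_of_subdomain[OF domain_D])

abbreviation fstar :: "'k set \<Rightarrow> 'k set" where
  "fstar \<equiv> finite_type D star"

text \<open>The fractional content: coefficients may lie anywhere in K, so a submodule is generated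
  instead of an ideal of \<open>D\<close>.\<close>

definition cont :: "'k poly \<Rightarrow> 'k set" where
  "cont p = is_submodule D hull range (coeff p)"

lemmas submodule_D_iff = submodule_iff[OF field_subring_axioms]

lemma submodule_hull: "is_submodule D (is_submodule D hull S)"
  by (rule hull_in) (auto simp: submodule_D_iff)

lemma submodule_cont: "is_submodule D (cont p)"
  unfolding cont_def by (rule submodule_hull)

lemma coeff_in_cont: "coeff p n \<in> cont p"
  unfolding cont_def by (rule hull_inc) simp

lemma cont_subset_iff: "is_submodule D E \<Longrightarrow> cont p \<subseteq> E \<longleftrightarrow> p \<in> polys_over E"
  unfolding cont_def mem_polys_over by (rule subset_hull)

lemma cont_subset_cont_glue: "cont p \<subseteq> cont (glue p q)" "cont q \<subseteq> cont (glue p q)"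
  unfolding cont_def range_coeff_glue by (rule hull_mono, blast)+

lemma ideal_submodule: "ideal I (ring_on D) \<longleftrightarrow> is_submodule D I \<and> I \<subseteq> D"
  by (auto simp: ideal_iff submodule_D_iff)

lemma submodule_D: "is_submodule D D"
  by (auto simp: submodule_D_iff add_mem mult_mem)

lemma D_Fbar: "D \<in> Fbar D"
  using one_mem submodule_D unfolding Fbar_def by fastforce

lemma Fbar_submodule: "E \<in> Fbar D \<Longrightarrow> is_submodule D E"
  by (simp add: Fbar_def)

lemma FbarI: "is_submodule D E \<Longrightarrow> x \<in> E \<Longrightarrow> x \<noteq> 0 \<Longrightarrow> E \<in> Fbar D"
  by (auto simp: Fbar_def)

lemma FbarE:
  assumes "E \<in> Fbar D"
  obtains x where "x \<in> E" "x \<noteq> 0"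
  using assms by (auto simp: Fbar_def submodule_D_iff)

lemma cont_Fbar: "p \<noteq> 0 \<Longrightarrow> cont p \<in> Fbar D"
  by (rule FbarI[OF submodule_cont coeff_in_cont, of p "degree p"]) simp

text \<open>A finite generating set can be listed as the coefficients of a polynomial; the extra
  coefficient 0 does not change the span. From here on, finitely generated modules are handled
  through polynomials only.\<close>

lemma fg_iff: "F \<in> fg D \<longleftrightarrow> (\<exists>p. p \<noteq> 0 \<and> F = cont p)"
proof
  assume F: "F \<in> fg D"
  then obtain S where S: "finite S" "F = is_submodule D hull S"
    by (auto simp: fg_def)
  obtain xs where xs: "set xs = S"
    using S(1) finite_list by blast
  have range: "range (coeff (Poly xs)) = insert 0 S"
  proof
    show "range (coeff (Poly xs)) \<subseteq> insert 0 S"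
      by (auto simp: nth_default_def coeff_Poly_eq simp flip: xs)
    \<comment> \<open>The index just past the end of the list shows that 0 is always among the
      coefficients.\<close>
    have "coeff (Poly xs) (length xs) = 0"
      by (simp add: coeff_Poly_eq nth_default_def)
    then have "0 \<in> range (coeff (Poly xs))"
      using rangeI[of "coeff (Poly xs)" "length xs"] by simp
    moreover have "xs ! i \<in> range (coeff (Poly xs))" if "i < length xs" for i
    proof -
      have "coeff (Poly xs) i = xs ! i"
        using that by (simp add: coeff_Poly_eq nth_default_def)
      then show ?thesis using rangeI[of "coeff (Poly xs)" i] by simp
    qed
    ultimately show "insert 0 S \<subseteq> range (coeff (Poly xs))"
      unfolding xs[symmetric] set_conv_nth by auto
  qed
  have "F = cont (Poly xs)"
  proof
    show "F \<subseteq> cont (Poly xs)"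
      unfolding S cont_def range by (rule hull_mono) blast
    have "insert 0 S \<subseteq> F"
      using submodule_hull[of S] hull_subset[of S "is_submodule D"]
      unfolding S submodule_D_iff by blast
    then show "cont (Poly xs) \<subseteq> F"
      unfolding cont_def range S by (rule hull_minimal) (rule submodule_hull)
  qed
  moreover have "Poly xs \<noteq> 0"
  proof
    assume "Poly xs = 0"
    with \<open>F = cont (Poly xs)\<close> have "F = is_submodule D hull {0}"
      by (simp add: cont_def image_def)
    then have "F = {0}" by (simp add: hull_same submodule_D_iff)
    with F show False by (simp add: fg_def Fbar_def)
  qed
  ultimately show "\<exists>p. p \<noteq> 0 \<and> F = cont p" by blast
next
  assume "\<exists>p. p \<noteq> 0 \<and> F = cont p"
  then obtain p where p: "p \<noteq> 0" "F = cont p" by blast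
  have "finite (range (coeff p))"
  proof (rule finite_subset)
    show "range (coeff p) \<subseteq> insert 0 (coeff p ` {..degree p})"
      using le_degree by blast
  qed simp
  then show "F \<in> fg D"
    using cont_Fbar[OF p(1)] p(2) by (auto simp: fg_def cont_def)
qed

text \<open>The submodule generated by elements of \<open>D\<close> stays inside \<open>D\<close>
  and is therefore an ideal, so the two generated objects agree.\<close>

lemma content_ideal_eq_cont:
  assumes "g \<in> polys_over D"
  shows "content_ideal D g = cont g"
proof -
  have "cont g \<subseteq> D"
    using assms submodule_D by (simp add: cont_subset_iff)
  then have "ideal (cont g) (ring_on D)"
    by (simp add: ideal_submodule submodule_cont)
  then show ?thesis
    by (auto simp: content_ideal_def genideal_def cont_def hull_def ideal_submodule)
qed

lemma submodule_scale:
  "is_submodule D E \<Longrightarrow> is_submodule D ((*) c ` E)"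
  unfolding submodule_D_iff
proof (intro conjI ballI)
  assume E: "0 \<in> E \<and> (\<forall>x\<in>E. \<forall>y\<in>E. x + y \<in> E) \<and> (\<forall>a\<in>D. \<forall>x\<in>E. a * x \<in> E)"
  show "0 \<in> (*) c ` E" using E by force
  show "x + y \<in> (*) c ` E" if "x \<in> (*) c ` E" "y \<in> (*) c ` E" for x y
    using that E by (auto simp: distrib_left[symmetric])
  show "a * x \<in> (*) c ` E" if "a \<in> D" "x \<in> (*) c ` E" for a x
    using that E by (auto simp: mult.left_commute[of a])
qed

lemma cont_smult:
  assumes "c \<noteq> 0"
  shows "cont (smult c p) = (*) c ` cont p"
proof
  show "cont (smult c p) \<subseteq> (*) c ` cont p"
    by (auto simp: cont_subset_iff submodule_scale submodule_cont polys_over_def coeff_in_cont)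
  have "cont p \<subseteq> (*) (inverse c) ` cont (smult c p)"
    unfolding cont_subset_iff[OF submodule_scale[OF submodule_cont]]
    unfolding polys_over_def
  proof (intro CollectI allI image_eqI)
    show "coeff p n = inverse c * coeff (smult c p) n" for n using assms by simp
  qed (rule coeff_in_cont)
  then have "(*) c ` cont p \<subseteq> (*) c ` (*) (inverse c) ` cont (smult c p)"
    by (rule image_mono)
  also have "\<dots> = cont (smult c p)"
    using assms by (simp add: image_image mult.assoc[symmetric])
  finally show "(*) c ` cont p \<subseteq> cont (smult c p)" .
qed


section \<open>Closure properties of the finite-type operation\<close>

subsection \<open>Semistar operations of finite type\<close>

lemma star_Fbar: "E \<in> Fbar D \<Longrightarrow> star E \<in> Fbar D"
  using semistar by (simp add: semistar_operation_def)

lemma star_scale: "x \<noteq> 0 \<Longrightarrow> E \<in> Fbar D \<Longrightarrow> star ((*) x ` E) = (*) x ` star E"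
  using semistar by (simp add: semistar_operation_def)

lemma star_mono: "E \<in> Fbar D \<Longrightarrow> F \<in> Fbar D \<Longrightarrow> E \<subseteq> F \<Longrightarrow> star E \<subseteq> star F"
  using semistar by (simp add: semistar_operation_def)

lemma star_extensive: "E \<in> Fbar D \<Longrightarrow> E \<subseteq> star E"
  using semistar by (simp add: semistar_operation_def)

lemma star_idem: "E \<in> Fbar D \<Longrightarrow> star (star E) = star E"
  using semistar by (simp add: semistar_operation_def)

lemma submodule_star_cont: "p \<noteq> 0 \<Longrightarrow> is_submodule D (star (cont p))"
  by (intro Fbar_submodule star_Fbar cont_Fbar)

text \<open>The working form of the finite-type operation: the finitely generated modules inside
  \<open>E\<close> are the contents of the nonzero polynomials over \<open>E\<close>.\<close>

lemma mem_fstar_iff: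
  "is_submodule D E \<Longrightarrow> x \<in> fstar E \<longleftrightarrow> (\<exists>p. p \<noteq> 0 \<and> p \<in> polys_over E \<and> x \<in> star (cont p))"
  unfolding finite_type_def fg_iff using cont_subset_iff[of E] by blast

lemma fstar_mono: "E \<subseteq> F \<Longrightarrow> fstar E \<subseteq> fstar F"
  by (auto simp: finite_type_def)

lemma star_cont_glue:
  assumes "p \<noteq> 0 \<or> q \<noteq> 0"
  shows "p \<noteq> 0 \<Longrightarrow> star (cont p) \<subseteq> star (cont (glue p q))"
    and "q \<noteq> 0 \<Longrightarrow> star (cont q) \<subseteq> star (cont (glue p q))"
  by (intro star_mono cont_Fbar glue_neq_0 cont_subset_cont_glue; use assms in simp)+

lemma fstar_extensive:
  assumes "E \<in> Fbar D"
  shows "E \<subseteq> fstar E"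
proof
  fix x assume x: "x \<in> E"
  obtain e where e: "e \<in> E" "e \<noteq> 0" using assms by (rule FbarE)
  have 0: "0 \<in> E" using Fbar_submodule[OF assms] by (simp add: submodule_D_iff)
  \<comment> \<open>Since \<open>x\<close> may be 0, a nonzero \<open>e\<close> is adjoined to keep
    the polynomial nonzero.\<close>
  have p: "[:e, x:] \<noteq> 0" using e by simp
  have "x \<in> cont [:e, x:]" using coeff_in_cont[of "[:e, x:]" 1] by simp
  then have "x \<in> star (cont [:e, x:])"
    using star_extensive[OF cont_Fbar[OF p]] by blast
  moreover have "[:e, x:] \<in> polys_over E"
    using e x 0 by (auto simp: polys_over_def coeff_pCons split: nat.split)
  ultimately show "x \<in> fstar E"
    using p mem_fstar_iff[OF Fbar_submodule[OF assms]] by blast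
qed

text \<open>The union defining \<open>fstar E\<close> is directed: \<open>glue\<close> combines two
  finitely generated modules inside \<open>E\<close> into one that contains both.\<close>

lemma submodule_fstar:
  assumes "E \<in> Fbar D"
  shows "is_submodule D (fstar E)"
  unfolding submodule_D_iff
proof (intro conjI ballI)
  note E = mem_fstar_iff[OF Fbar_submodule[OF assms]]
  show "0 \<in> fstar E"
    using fstar_extensive[OF assms] Fbar_submodule[OF assms] by (auto simp: submodule_D_iff)
  fix x assume "x \<in> fstar E"
  then obtain p where p: "p \<noteq> 0" "p \<in> polys_over E" "x \<in> star (cont p)"
    by (auto simp: E)
  show "a * x \<in> fstar E" if "a \<in> D" for a
    using that p submodule_star_cont[of p] by (auto simp: E submodule_D_iff)
  fix y assume "y \<in> fstar E"
  then obtain q where q: "q \<noteq> 0" "q \<in> polys_over E" "y \<in> star (cont q)"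
    by (auto simp: E)
  have "glue p q \<noteq> 0" "glue p q \<in> polys_over E"
    using p q by (auto simp: glue_neq_0 polys_over_glue)
  moreover have "x + y \<in> star (cont (glue p q))"
    using star_cont_glue[of p q] p q submodule_star_cont[of "glue p q"] glue_neq_0[of p q]
    by (auto simp: submodule_D_iff)
  ultimately show "x + y \<in> fstar E" by (auto simp: E)
qed

lemma fstar_Fbar: "E \<in> Fbar D \<Longrightarrow> fstar E \<in> Fbar D"
  by (meson FbarE FbarI fstar_extensive submodule_fstar subsetD)

text \<open>By directedness, the finitely many coefficients of \<open>q\<close> lie in the closure
  of a single finitely generated submodule of \<open>E\<close>. The induction collects it by gluing,
  one coefficient at a time.\<close>

lemma polys_over_fstar:
  assumes "E \<in> Fbar D" and "q \<in> polys_over (fstar E)"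
  shows "\<exists>p. p \<noteq> 0 \<and> p \<in> polys_over E \<and> q \<in> polys_over (star (cont p))"
  using assms(2)
proof (induction q)
  case 0
  obtain e where e: "e \<in> E" "e \<noteq> 0" using assms(1) by (rule FbarE)
  have E0: "0 \<in> E" using Fbar_submodule[OF assms(1)] by (simp add: submodule_D_iff)
  show ?case
  proof (intro exI conjI)
    show "[:e:] \<noteq> 0" using e by simp
    then show "0 \<in> polys_over (star (cont [:e:]))"
      using submodule_star_cont by (simp add: polys_over_def submodule_D_iff)
    show "[:e:] \<in> polys_over E"
      using e E0 by (auto simp: polys_over_def coeff_pCons split: nat.split)
  qed
next
  case (pCons a q)
  have a: "a \<in> fstar E" and q: "q \<in> polys_over (fstar E)"
    using polys_over_coeff[OF pCons.prems, of 0] polys_over_coeff[OF pCons.prems, of "Suc n" for n]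
    by (auto simp: polys_over_def)
  obtain p where p: "p \<noteq> 0" "p \<in> polys_over E" "q \<in> polys_over (star (cont p))"
    using pCons.IH[OF q] by blast
  obtain r where r: "r \<noteq> 0" "r \<in> polys_over E" "a \<in> star (cont r)"
    using a by (auto simp: mem_fstar_iff[OF Fbar_submodule[OF assms(1)]])
  show ?case
  proof (intro exI conjI)
    show "glue p r \<noteq> 0" "glue p r \<in> polys_over E"
      using p r by (auto simp: glue_neq_0 polys_over_glue)
    show "pCons a q \<in> polys_over (star (cont (glue p r)))"
      using p r star_cont_glue[of p r]
      by (auto simp: polys_over_def coeff_pCons split: nat.split)
  qed
qed

lemma fstar_idem:
  assumes "E \<in> Fbar D"
  shows "fstar (fstar E) = fstar E"
proof
  show "fstar E \<subseteq> fstar (fstar E)"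
    using assms by (intro fstar_extensive fstar_Fbar)
  show "fstar (fstar E) \<subseteq> fstar E"
  proof
    fix x assume "x \<in> fstar (fstar E)"
    then obtain q where q: "q \<noteq> 0" "q \<in> polys_over (fstar E)" "x \<in> star (cont q)"
      using submodule_fstar[OF assms] by (auto simp: mem_fstar_iff)
    obtain p where p: "p \<noteq> 0" "p \<in> polys_over E" "q \<in> polys_over (star (cont p))"
      using polys_over_fstar[OF assms q(2)] by blast
    \<comment> \<open>All coefficients of \<open>q\<close> lie in the closed module
      \<open>star (cont p)\<close>, so idempotence of \<open>star\<close> carries over to
      \<open>fstar\<close>.\<close>
    have "star (cont q) \<subseteq> star (star (cont p))"
      using p q by (intro star_mono cont_Fbar star_Fbar)
        (auto simp: cont_subset_iff submodule_star_cont)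
    then show "x \<in> fstar E"
      using p q Fbar_submodule[OF assms] by (auto simp: mem_fstar_iff star_idem cont_Fbar)
  qed
qed


section \<open>Quasi-ideals: closure, chains, existence and primality of the maximal ones\<close>

subsection \<open>Quasi-ideals\<close>

lemma ideal_Fbar: "ideal I (ring_on D) \<Longrightarrow> I \<noteq> {0} \<Longrightarrow> I \<in> Fbar D"
  by (simp add: Fbar_def ideal_submodule)

text \<open>By monotonicity and idempotence, closing \<open>fstar I \<inter> D\<close> cannot leave
  \<open>fstar I\<close>.\<close>

lemma quasi_star_ideal_fstar:
  assumes "ideal I (ring_on D)" "I \<noteq> {0}"
  shows "quasi_star_ideal D fstar (fstar I \<inter> D)"
proof -
  have I: "I \<in> Fbar D" using assms by (rule ideal_Fbar)
  have sub: "I \<subseteq> fstar I \<inter> D"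
    using fstar_extensive[OF I] assms(1) by (auto simp: ideal_submodule)
  have id: "ideal (fstar I \<inter> D) (ring_on D)"
    using submodule_fstar[OF I] by (auto simp: ideal_iff submodule_D_iff add_mem mult_mem)
  have ne: "fstar I \<inter> D \<noteq> {0}"
    using sub I by (auto elim: FbarE)
  have "fstar (fstar I \<inter> D) \<subseteq> fstar I"
    using fstar_mono[of "fstar I \<inter> D" "fstar I"] fstar_idem[OF I] by blast
  then have "fstar (fstar I \<inter> D) \<inter> D = fstar I \<inter> D"
    using fstar_extensive[OF ideal_Fbar[OF id ne]] by blast
  with id ne show ?thesis by (simp add: quasi_star_ideal_def)
qed

lemma quasi_star_ideal_neq_iff:
  "quasi_star_ideal D s I \<Longrightarrow> I \<noteq> D \<longleftrightarrow> 1 \<notin> I"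
  by (auto simp: quasi_star_ideal_def proper_ideal_iff)

text \<open>Finite type is essential here: membership in the closure of the union is witnessed by
  one polynomial, whose finitely many coefficients already lie in a single member of the
  chain.\<close>

lemma quasi_star_ideal_Union:
  assumes "subset.chain {I. quasi_star_ideal D fstar I \<and> I \<noteq> D} C" and "C \<noteq> {}"
  shows "quasi_star_ideal D fstar (\<Union>C) \<and> \<Union>C \<noteq> D"
proof -
  have C: "quasi_star_ideal D fstar I" "I \<noteq> D" if "I \<in> C" for I
    using assms(1) that by (auto simp: subset.chain_def)
  have join: "\<exists>L\<in>C. I \<subseteq> L \<and> J \<subseteq> L" if "I \<in> C" "J \<in> C" for I J
  proof -
    have "I \<subseteq> J \<or> J \<subseteq> I"
      using assms(1) that by (auto simp: subset.chain_def)
    with that show ?thesis by auto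
  qed
  have idI: "ideal I (ring_on D)" if "I \<in> C" for I
    using C that by (simp add: quasi_star_ideal_def)
  have id: "ideal (\<Union>C) (ring_on D)"
    unfolding ideal_iff
  proof (intro conjI ballI)
    show "\<Union>C \<subseteq> D" using idI by (simp add: ideal_iff Sup_least)
    show "0 \<in> \<Union>C" using idI assms(2) by (auto simp: ideal_iff)
    show "a * x \<in> \<Union>C" if "a \<in> D" "x \<in> \<Union>C" for a x
      using that(2)
    proof
      fix I assume "I \<in> C" "x \<in> I"
      then have "a * x \<in> I" using idI[of I] that(1) by (simp add: ideal_iff)
      then show ?thesis using \<open>I \<in> C\<close> by (rule UnionI[rotated])
    qed
    fix x y assume "x \<in> \<Union>C" "y \<in> \<Union>C"
    then obtain I J where IJ: "I \<in> C" "x \<in> I" "J \<in> C" "y \<in> J" by (elim UnionE)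
    obtain L where L: "L \<in> C" "I \<subseteq> L" "J \<subseteq> L" using join[OF IJ(1,3)] by blast
    then have "x + y \<in> L" using IJ idI[of L] by (simp add: ideal_iff subset_iff)
    then show "x + y \<in> \<Union>C" using L(1) by (rule UnionI[rotated])
  qed
  have ne: "\<Union>C \<noteq> {0}"
  proof -
    obtain I where "I \<in> C" using assms(2) by blast
    then have "I \<in> Fbar D" using C idI ideal_Fbar by (simp add: quasi_star_ideal_def)
    then show ?thesis using \<open>I \<in> C\<close> by (auto elim: FbarE)
  qed
  have fin: "\<exists>I\<in>C. p \<in> polys_over I" if "p \<in> polys_over (\<Union>C)" for p
    using that
  proof (induction p)
    case 0
    obtain I where "I \<in> C" using assms(2) by blast
    then show ?case using idI by (auto simp: polys_over_def ideal_iff)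
  next
    case (pCons a p)
    have "a \<in> \<Union>C" "p \<in> polys_over (\<Union>C)"
      using polys_over_coeff[OF pCons.prems, of 0] polys_over_coeff[OF pCons.prems, of "Suc n" for n]
      by (auto simp: polys_over_def)
    then obtain I J where IJ: "I \<in> C" "a \<in> I" "J \<in> C" "p \<in> polys_over J"
      using pCons.IH by (elim UnionE) blast
    obtain L where L: "L \<in> C" "I \<subseteq> L" "J \<subseteq> L"
      using join[OF IJ(1,3)] by blast
    then have "L \<in> C" "a \<in> L" "p \<in> polys_over L"
      using IJ polys_over_mono[of J L] by auto
    then show ?case by (auto simp: polys_over_def coeff_pCons split: nat.split)
  qed
  have sub: "is_submodule D I" if "ideal I (ring_on D)" for I
    using that by (simp add: ideal_submodule)
  have "fstar (\<Union>C) \<inter> D \<subseteq> \<Union>C"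
  proof
    fix x assume x: "x \<in> fstar (\<Union>C) \<inter> D"
    then obtain p where p: "p \<noteq> 0" "p \<in> polys_over (\<Union>C)" "x \<in> star (cont p)"
      unfolding Int_iff mem_fstar_iff[OF sub[OF id]] by blast
    obtain I where I: "I \<in> C" "p \<in> polys_over I" using fin[OF p(2)] by blast
    then have "x \<in> fstar I"
      using p mem_fstar_iff[OF sub[OF idI]] by blast
    then have "x \<in> I"
      using C(1)[OF I(1)] x unfolding quasi_star_ideal_def by blast
    then show "x \<in> \<Union>C" using I(1) by blast
  qed
  then have "fstar (\<Union>C) \<inter> D = \<Union>C"
    using fstar_extensive[OF ideal_Fbar[OF id ne]] id unfolding ideal_iff by blast
  then have quasi: "quasi_star_ideal D fstar (\<Union>C)"
    using id ne by (simp add: quasi_star_ideal_def)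
  moreover have "1 \<notin> I" if "I \<in> C" for I
    using C[OF that] by (simp add: quasi_star_ideal_neq_iff)
  then have "\<Union>C \<noteq> D"
    using quasi_star_ideal_neq_iff[OF quasi] by simp
  ultimately show ?thesis by simp
qed

text \<open>Zorn's lemma among the proper quasi-ideals above \<open>fstar I \<inter> D\<close>,
  which is itself proper because its closure misses 1.\<close>

lemma QMax_exists:
  assumes "ideal I (ring_on D)" "I \<noteq> {0}" "1 \<notin> fstar I"
  obtains M where "M \<in> QMax D fstar" "I \<subseteq> M"
proof -
  let ?Q = "{J. quasi_star_ideal D fstar J \<and> J \<noteq> D}"
  let ?A = "{J. quasi_star_ideal D fstar J \<and> J \<noteq> D \<and> fstar I \<inter> D \<subseteq> J}"
  have I: "fstar I \<inter> D \<in> ?A"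
    using quasi_star_ideal_fstar[OF assms(1,2)] assms(3) quasi_star_ideal_neq_iff by auto
  have "\<exists>M\<in>?A. \<forall>X\<in>?A. M \<subseteq> X \<longrightarrow> X = M"
  proof (rule subset_Zorn_nonempty)
    show "?A \<noteq> {}" using I by blast
    fix C assume C: "C \<noteq> {}" "subset.chain ?A C"
    then have "subset.chain ?Q C" by (auto simp: subset.chain_def)
    then have "quasi_star_ideal D fstar (\<Union>C) \<and> \<Union>C \<noteq> D"
      using C(1) by (rule quasi_star_ideal_Union)
    moreover have "fstar I \<inter> D \<subseteq> \<Union>C"
    proof -
      obtain J where "J \<in> C" using C(1) by blast
      moreover from this have "fstar I \<inter> D \<subseteq> J" using C(2) by (auto simp: subset.chain_def)
      ultimately show ?thesis by (simp add: Union_upper subset_trans)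
    qed
    ultimately show "\<Union>C \<in> ?A" by simp
  qed
  then obtain M where M: "M \<in> ?A" "\<forall>X\<in>?A. M \<subseteq> X \<longrightarrow> X = M" by blast
  then have "M \<in> QMax D fstar" by (auto simp: QMax_def)
  moreover have "I \<subseteq> M"
    using M(1) fstar_extensive[OF ideal_Fbar[OF assms(1,2)]] assms(1)
    by (auto simp: ideal_iff)
  ultimately show ?thesis by (rule that)
qed

text \<open>If \<open>a * b\<close> lies in \<open>M\<close> but \<open>a\<close> does not,
  maximality puts 1 into the closure of \<open>M + D a\<close>. Multiplying by \<open>b\<close>
  moves this module into \<open>M\<close> and 1 to \<open>b\<close>, so \<open>b\<close> lies in
  \<open>fstar M \<inter> D = M\<close>.\<close>

lemma QMax_subset_QSpec: "QMax D fstar \<subseteq> QSpec D fstar"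
proof
  fix M assume M: "M \<in> QMax D fstar"
  then have quasi: "quasi_star_ideal D fstar M" and "M \<noteq> D"
    and max: "\<And>I. quasi_star_ideal D fstar I \<Longrightarrow> I \<noteq> D \<Longrightarrow> M \<subseteq> I \<Longrightarrow> I = M"
    by (auto simp: QMax_def)
  then have id: "ideal M (ring_on D)" and ne: "M \<noteq> {0}" and MD: "fstar M \<inter> D = M"
    by (auto simp: quasi_star_ideal_def)
  have subM: "is_submodule D M" using id by (simp add: ideal_submodule)
  have "b \<in> M" if ab: "a \<in> D" "b \<in> D" "a * b \<in> M" and a: "a \<notin> M" for a b
  proof (cases "b = 0")
    case True
    then show ?thesis using id by (simp add: ideal_iff)
  next
    case False
    let ?N = "{m + d * a | m d. m \<in> M \<and> d \<in> D}"
    have N: "ideal ?N (ring_on D)"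
      unfolding ideal_iff
    proof (intro conjI ballI)
      show "?N \<subseteq> D" using id ab by (auto simp: ideal_iff intro!: add_mem mult_mem)
      show "0 \<in> ?N" using id by (force simp: ideal_iff)
    next
      fix x y assume "x \<in> ?N" "y \<in> ?N"
      then obtain m d n e where "m \<in> M" "n \<in> M" "d \<in> D" "e \<in> D" "x = m + d * a" "y = n + e * a"
        by blast
      then show "x + y \<in> ?N"
        using id by (intro CollectI exI[of _ "m + n"] exI[of _ "d + e"])
          (auto simp: ideal_iff add_mem algebra_simps)
    next
      fix c x assume "c \<in> D" "x \<in> ?N"
      then obtain m d where "m \<in> M" "d \<in> D" "x = m + d * a" by blast
      then show "c * x \<in> ?N"
        using id \<open>c \<in> D\<close> by (intro CollectI exI[of _ "c * m"] exI[of _ "c * d"])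
          (auto simp: ideal_iff mult_mem algebra_simps)
    qed
    have MN: "M \<subseteq> ?N"
      by (rule subsetI, rule CollectI, rule exI, rule exI[of _ 0]) simp
    have aN: "a \<in> ?N"
      using id by (intro CollectI exI[of _ 0] exI[of _ 1]) (auto simp: ideal_iff)
    have neN: "?N \<noteq> {0}"
    proof
      assume "?N = {0}"
      with aN have "a = 0" by simp
      with a id show False by (simp add: ideal_iff)
    qed
    have "1 \<in> fstar ?N"
    proof (rule ccontr)
      assume "1 \<notin> fstar ?N"
      then obtain M' where M': "M' \<in> QMax D fstar" "?N \<subseteq> M'"
        using QMax_exists[OF N neN] by blast
      then have "M' = M" using max[of M'] MN by (auto simp: QMax_def)
      with M' aN a show False by blast
    qed
    then obtain p where p: "p \<noteq> 0" "p \<in> polys_over ?N" "1 \<in> star (cont p)"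
      using N by (auto simp: mem_fstar_iff ideal_submodule)
    have "b * (m + d * a) \<in> M" if "m \<in> M" "d \<in> D" for m d
    proof -
      have "b * m + d * (a * b) \<in> M" using id ab that by (simp add: ideal_iff)
      then show ?thesis by (simp add: algebra_simps)
    qed
    \<comment> \<open>Compatibility of \<open>star\<close> with scaling requires a nonzero factor,
      which is why \<open>b = 0\<close> was treated apart.\<close>
    then have "smult b p \<in> polys_over M"
      using p(2) unfolding polys_over_def coeff_smult mem_Collect_eq by metis
    moreover have "b \<in> star (cont (smult b p))"
      unfolding cont_smult[OF False] star_scale[OF False cont_Fbar[OF p(1)]]
      using p(3) by force
    moreover have "smult b p \<noteq> 0" using p False by simp
    ultimately have "b \<in> fstar M" using mem_fstar_iff[OF subM] by blast
    then show ?thesis using MD ab by blast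
  qed
  then have "primeideal M (ring_on D)"
    using id \<open>M \<noteq> D\<close> by (auto simp: primeideal_iff)
  with quasi show "M \<in> QSpec D fstar" by (simp add: QSpec_def)
qed

end


section \<open>Polynomials with coefficients in an ideal; primality of P[X]\<close>

subsection \<open>Polynomials over subrings and ideals\<close>

context field_subring
begin

lemma ideal_sum_mem:
  "ideal I (ring_on A) \<Longrightarrow> (\<And>i. i \<in> S \<Longrightarrow> f i \<in> I) \<Longrightarrow> sum f S \<in> I"
  by (induction S rule: infinite_finite_induct) (auto simp: ideal_iff)

lemma polys_over_mult_ideal:
  assumes "ideal I (ring_on A)" "f \<in> polys_over A" "g \<in> polys_over I"
  shows "f * g \<in> polys_over I"
  unfolding polys_over_def coeff_mult mem_Collect_eq
proof (intro allI ideal_sum_mem[OF assms(1)])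
  fix n i
  show "coeff f i * coeff g (n - i) \<in> I"
    using assms(1) polys_over_coeff[OF assms(2)] polys_over_coeff[OF assms(3)]
    by (simp add: ideal_iff)
qed

lemma polys_over_add_ideal:
  "ideal I (ring_on A) \<Longrightarrow> f \<in> polys_over I \<Longrightarrow> g \<in> polys_over I \<Longrightarrow> f + g \<in> polys_over I"
  by (auto simp: polys_over_def ideal_iff)

lemma ideal_self: "ideal A (ring_on A)"
  by (simp add: ideal_iff add_mem mult_mem)

lemmas polys_over_mult = polys_over_mult_ideal[OF ideal_self]
lemmas polys_over_add = polys_over_add_ideal[OF ideal_self]

lemma polys_over_pCons: "pCons a f \<in> polys_over A \<longleftrightarrow> a \<in> A \<and> f \<in> polys_over A"
proof
  assume *: "pCons a f \<in> polys_over A"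
  show "a \<in> A \<and> f \<in> polys_over A"
    using polys_over_coeff[OF *, of 0] polys_over_coeff[OF *, of "Suc n" for n]
    by (simp add: polys_over_def)
qed (simp add: polys_over_def coeff_pCons split: nat.split)

lemma polys_over_0: "0 \<in> polys_over A"
  by (simp add: polys_over_def)

lemma polys_over_1: "1 \<in> polys_over A"
  by (simp add: one_pCons polys_over_pCons polys_over_0)

lemma polys_over_uminus: "f \<in> polys_over A \<Longrightarrow> - f \<in> polys_over A"
  by (simp add: polys_over_def uminus_mem)

text \<open>Gauss' argument: let \<open>i\<close> and \<open>j\<close> be the first indices where
  \<open>f\<close> and \<open>g\<close> have coefficients outside \<open>P\<close>. In degree
  \<open>i + j\<close> every other product lies in \<open>P\<close>, so
  \<open>coeff f i * coeff g j\<close> would lie there too.\<close>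

lemma polys_over_prime:
  assumes P: "primeideal P (ring_on A)" and fg: "f \<in> polys_over A" "g \<in> polys_over A"
    and "f * g \<in> polys_over P"
  shows "f \<in> polys_over P \<or> g \<in> polys_over P"
proof (rule ccontr)
  assume neg: "\<not> ?thesis"
  have id: "ideal P (ring_on A)"
    and prime: "\<And>a b. a \<in> A \<Longrightarrow> b \<in> A \<Longrightarrow> a * b \<in> P \<Longrightarrow> a \<in> P \<or> b \<in> P"
    using P by (auto simp: primeideal_iff)
  have P_add: "\<And>x y. x \<in> P \<Longrightarrow> y \<in> P \<Longrightarrow> x + y \<in> P"
    and P_mult: "\<And>a x. a \<in> A \<Longrightarrow> x \<in> P \<Longrightarrow> a * x \<in> P"
    using id by (auto simp: ideal_iff)
  obtain i where i: "coeff f i \<notin> P" "\<And>k. k < i \<Longrightarrow> coeff f k \<in> P"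
    using neg exists_least_iff[of "\<lambda>i. coeff f i \<notin> P"] by (auto simp: polys_over_def)
  obtain j where j: "coeff g j \<notin> P" "\<And>k. k < j \<Longrightarrow> coeff g k \<in> P"
    using neg exists_least_iff[of "\<lambda>i. coeff g i \<notin> P"] by (auto simp: polys_over_def)
  let ?t = "\<lambda>k. coeff f k * coeff g (i + j - k)"
  have "?t k \<in> P" if "k \<in> {..i + j} - {i}" for k
  proof (cases "k < i")
    case True
    have "coeff g (i + j - k) * coeff f k \<in> P"
      using i(2)[OF True] polys_over_coeff[OF fg(2)] by (rule P_mult[rotated])
    then show ?thesis by (simp add: mult.commute)
  next
    case False
    then have "i + j - k < j" using that by auto
    from j(2)[OF this] show ?thesis by (rule P_mult[OF polys_over_coeff[OF fg(1)]])
  qed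
  then have "sum ?t ({..i + j} - {i}) \<in> P"
    by (rule ideal_sum_mem[OF id])
  then have *: "- 1 * sum ?t ({..i + j} - {i}) \<in> P"
    by (rule P_mult[OF uminus_mem[OF one_mem]])
  have "coeff (f * g) (i + j) = ?t i + sum ?t ({..i + j} - {i})"
    unfolding coeff_mult by (rule sum.remove) auto
  then have "coeff f i * coeff g j = coeff (f * g) (i + j) + - 1 * sum ?t ({..i + j} - {i})"
    by simp
  then have "coeff f i * coeff g j \<in> P"
    using P_add[OF polys_over_coeff[OF assms(4), of "i + j"] *] by (simp only:)
  then show False
    using prime[OF polys_over_coeff[OF fg(1), of i] polys_over_coeff[OF fg(2), of j]] i(1) j(1)
    by simp
qed

end


section \<open>Denominators as the polynomials outside every M[X]\<close>

subsection \<open>The denominators of the Nagata ring\<close>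

context semistar_domain
begin

definition denoms :: "'k poly set" where
  "denoms = {g \<in> polys_over D. g \<noteq> 0 \<and> star (content_ideal D g) = star D}"

text \<open>Since \<open>star (cont g)\<close> is a \<open>D\<close>-module, containing 1 means
  containing \<open>D\<close>; idempotence then gives equality with \<open>star D\<close>.\<close>

lemma denoms_iff: "g \<in> denoms \<longleftrightarrow> g \<in> polys_over D \<and> g \<noteq> 0 \<and> 1 \<in> star (cont g)"
proof -
  have "star (cont g) = star D \<longleftrightarrow> 1 \<in> star (cont g)" if g: "g \<in> polys_over D" "g \<noteq> 0"
  proof
    assume "star (cont g) = star D"
    then show "1 \<in> star (cont g)"
      using star_extensive[OF D_Fbar] one_mem by blast
  next
    assume 1: "1 \<in> star (cont g)"
    have F: "cont g \<in> Fbar D" using g(2) by (rule cont_Fbar)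
    have "a * 1 \<in> star (cont g)" if "a \<in> D" for a
      using 1 that submodule_star_cont[OF g(2)] unfolding submodule_D_iff by blast
    then have "star D \<subseteq> star (star (cont g))"
      by (intro star_mono D_Fbar star_Fbar F) auto
    moreover have "star (cont g) \<subseteq> star D"
      using g(1) by (intro star_mono D_Fbar F) (simp add: cont_subset_iff submodule_D)
    ultimately show "star (cont g) = star D" using star_idem[OF F] by simp
  qed
  then show ?thesis
    unfolding denoms_def mem_Collect_eq by (metis content_ideal_eq_cont)
qed

lemma QSpecD:
  assumes "P \<in> QSpec D fstar"
  shows "primeideal P (ring_on D)" "ideal P (ring_on D)" "is_submodule D P" "P \<subseteq> D" "1 \<notin> P"
    "P \<noteq> {0}" "fstar P \<inter> D = P"
proof -
  show "primeideal P (ring_on D)" and id: "ideal P (ring_on D)" and "P \<noteq> {0}" "fstar P \<inter> D = P"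
    using assms by (simp_all add: QSpec_def quasi_star_ideal_def)
  then show "is_submodule D P" "P \<subseteq> D" "1 \<notin> P"
    by (simp_all add: primeideal_iff ideal_submodule flip: proper_ideal_iff[OF id])
qed

lemma QSpec_star_cont:
  assumes "P \<in> QSpec D fstar" "p \<noteq> 0" "p \<in> polys_over P" "x \<in> star (cont p)" "x \<in> D"
  shows "x \<in> P"
proof -
  have "x \<in> fstar P"
    using assms mem_fstar_iff[OF QSpecD(3)[OF assms(1)]] by blast
  then show ?thesis using QSpecD(7)[OF assms(1)] assms(5) by blast
qed

lemma denoms_not_polys_over:
  assumes "P \<in> QSpec D fstar" "g \<in> denoms"
  shows "g \<notin> polys_over P"
proof
  assume "g \<in> polys_over P"
  then have "1 \<in> P"
    using assms(2) one_mem by (intro QSpec_star_cont[OF assms(1), of g]) (simp_all add: denoms_iff)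
  with QSpecD(5)[OF assms(1)] show False by contradiction
qed

text \<open>
  Gluing shifts one polynomial past the other, so that a set of polynomials closed under gluing
  contains, with any finite set of coefficients, a single polynomial having all of them.
\<close>

lemma glue_closed_subset_QMax:
  assumes sub: "I \<subseteq> polys_over D" and glue: "\<And>f g. f \<in> I \<Longrightarrow> g \<in> I \<Longrightarrow> glue f g \<in> I"
    and h: "h \<in> I" "h \<noteq> 0" and disj: "I \<inter> denoms = {}"
  obtains M where "M \<in> QMax D fstar" "I \<subseteq> polys_over M"
proof -
  \<comment> \<open>The ideal of all coefficients of members of \<open>I\<close>. Closure under
    gluing makes the union directed, so a finite part of it comes from one \<open>f\<close>; if its
    closure contained 1, that \<open>f\<close> would be a denominator.\<close>
  let ?C = "\<Union>f\<in>I. cont f"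
  have cont: "0 \<in> cont f" "x \<in> cont f \<Longrightarrow> y \<in> cont f \<Longrightarrow> x + y \<in> cont f"
    "a \<in> D \<Longrightarrow> x \<in> cont f \<Longrightarrow> a * x \<in> cont f" for f a x y
    using submodule_cont[of f] by (simp_all add: submodule_D_iff)
  have "cont f \<subseteq> D" if "f \<in> I" for f
    using subsetD[OF sub that] by (simp add: cont_subset_iff submodule_D)
  then have C: "ideal ?C (ring_on D)"
    unfolding ideal_iff
  proof (intro conjI ballI)
    show "0 \<in> ?C" using cont(1) h(1) by (rule UN_I[rotated])
    show "a * x \<in> ?C" if "a \<in> D" "x \<in> ?C" for a x
      using that(2)
    proof
      fix f assume f: "f \<in> I" "x \<in> cont f"
      show ?thesis using f(1) cont(3)[OF that(1) f(2)] by (rule UN_I)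
    qed
    fix x y assume "x \<in> ?C" "y \<in> ?C"
    then obtain f g where fg: "f \<in> I" "g \<in> I" "x \<in> cont f" "y \<in> cont g"
      by (elim UN_E)
    then have "x + y \<in> cont (glue f g)"
      using cont_subset_cont_glue[of f g] cont_subset_cont_glue[of g f]
      by (intro cont(2)) auto
    with glue[OF fg(1,2)] show "x + y \<in> ?C" by (rule UN_I)
  qed auto
  have "coeff h (degree h) \<in> ?C" using coeff_in_cont h(1) by blast
  then have ne: "?C \<noteq> {0}" using h(2) by (metis leading_coeff_0_iff singletonD)
  have fin: "\<exists>f\<in>I. p \<in> polys_over (cont f)" if "p \<in> polys_over ?C" for p
    using that
  proof (induction p)
    case 0
    show ?case using h(1) cont(1) by (auto simp: polys_over_def)
  next
    case (pCons a p)
    have "a \<in> ?C" "p \<in> polys_over ?C"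
      using polys_over_coeff[OF pCons.prems, of 0] polys_over_coeff[OF pCons.prems, of "Suc n" for n]
      by (simp_all add: polys_over_def)
    then obtain f g where fg: "f \<in> I" "g \<in> I" "a \<in> cont f" "p \<in> polys_over (cont g)"
      using pCons.IH by blast
    have "a \<in> cont (glue f g)" "p \<in> polys_over (cont (glue f g))"
      using fg cont_subset_cont_glue(1)[of f g] polys_over_mono[OF cont_subset_cont_glue(2)[of g f]]
      by auto
    then have "pCons a p \<in> polys_over (cont (glue f g))"
      by (simp add: polys_over_def coeff_pCons split: nat.split)
    then show ?case using glue[OF fg(1,2)] by blast
  qed
  have "1 \<notin> fstar ?C"
  proof
    assume "1 \<in> fstar ?C"
    then obtain p where p: "p \<noteq> 0" "p \<in> polys_over ?C" "1 \<in> star (cont p)"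
      using C mem_fstar_iff[of ?C] unfolding ideal_submodule by blast
    obtain f where f: "f \<in> I" "p \<in> polys_over (cont f)" using fin[OF p(2)] by blast
    have sub': "cont p \<subseteq> cont f" using f(2) by (simp add: cont_subset_iff submodule_cont)
    have "f \<noteq> 0"
    proof
      assume "f = 0"
      then have "cont f = {0}"
        by (simp add: cont_def image_def hull_same submodule_D_iff)
      with f(2) p(1) show False by (auto simp: polys_over_def poly_eq_iff)
    qed
    then have "1 \<in> star (cont f)"
      using star_mono[OF cont_Fbar cont_Fbar sub'] p by blast
    then have "f \<in> denoms" using \<open>f \<noteq> 0\<close> f(1) sub by (auto simp: denoms_iff)
    then show False using f(1) disj by blast
  qed
  then obtain M where M: "M \<in> QMax D fstar" "?C \<subseteq> M"
    by (rule QMax_exists[OF C ne])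
  have "I \<subseteq> polys_over M"
  proof
    fix f assume "f \<in> I"
    then have "cont f \<subseteq> M" using M(2) by blast
    then show "f \<in> polys_over M" using coeff_in_cont by (auto simp: polys_over_def)
  qed
  with M(1) show ?thesis by (rule that)
qed

text \<open>If \<open>g\<close> is not a denominator, the closure of its content misses 1, and so
  the content lies in some maximal quasi-ideal.\<close>

lemma denoms_iff_QMax:
  assumes "g \<in> polys_over D" "g \<noteq> 0"
  shows "g \<in> denoms \<longleftrightarrow> (\<forall>M\<in>QMax D fstar. g \<notin> polys_over M)"
proof
  show "g \<in> denoms \<Longrightarrow> \<forall>M\<in>QMax D fstar. g \<notin> polys_over M"
    using denoms_not_polys_over QMax_subset_QSpec by blast
next
  assume *: "\<forall>M\<in>QMax D fstar. g \<notin> polys_over M"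
  show "g \<in> denoms"
  proof (rule ccontr)
    assume "g \<notin> denoms"
    then have 1: "1 \<notin> star (cont g)" using assms by (simp add: denoms_iff)
    \<comment> \<open>The content is the largest finitely generated submodule of itself, so
      \<open>fstar\<close> adds nothing to \<open>star\<close> here.\<close>
    have "fstar (cont g) \<subseteq> star (cont g)"
    proof
      fix x assume "x \<in> fstar (cont g)"
      then obtain p where "p \<noteq> 0" "p \<in> polys_over (cont g)" "x \<in> star (cont p)"
        using mem_fstar_iff[OF submodule_cont] by blast
      then show "x \<in> star (cont g)"
        using star_mono[of "cont p" "cont g"] assms(2) cont_Fbar cont_subset_iff[OF submodule_cont]
        by blast
    qed
    with 1 have "1 \<notin> fstar (cont g)" by blast
    have "ideal (cont g) (ring_on D)"
      using assms(1) by (simp add: ideal_submodule submodule_cont cont_subset_iff submodule_D)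
    moreover have "cont g \<noteq> {0}"
      using cont_Fbar[OF assms(2)] by (simp add: Fbar_def)
    ultimately obtain M where M: "M \<in> QMax D fstar" "cont g \<subseteq> M"
      using \<open>1 \<notin> fstar (cont g)\<close> by (rule QMax_exists)
    have "g \<in> polys_over M"
      using M(2) coeff_in_cont by (auto simp: polys_over_def)
    with M(1) * show False by blast
  qed
qed

text \<open>Each M[X] is prime, so a product of two polynomials outside it stays outside.\<close>

lemma denoms_mult:
  assumes "f \<in> denoms" "g \<in> denoms"
  shows "f * g \<in> denoms"
proof -
  have fg: "f \<in> polys_over D" "f \<noteq> 0" "g \<in> polys_over D" "g \<noteq> 0"
    using assms by (auto simp: denoms_iff)
  have "f * g \<notin> polys_over M" if "M \<in> QMax D fstar" for M
  proof -
    have M: "M \<in> QSpec D fstar" using that QMax_subset_QSpec by blast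
    show ?thesis
      using polys_over_prime[OF QSpecD(1)[OF M] fg(1,3)] denoms_not_polys_over[OF M] assms
      by blast
  qed
  then show ?thesis
    using fg by (subst denoms_iff_QMax) (auto intro: polys_over_mult)
qed

lemma denoms_1: "1 \<in> denoms"
proof -
  have "1 \<in> cont 1" using coeff_in_cont[of 1 0] by simp
  then show ?thesis
    using subsetD[OF star_extensive[OF cont_Fbar[of 1]]] by (simp add: denoms_iff polys_over_1)
qed

end


section \<open>Consequences of the PstarMD condition at a single prime\<close>

subsection \<open>Localizing at a prime quasi-ideal\<close>

locale pstar_md = semistar_domain +
  assumes PstarMD: "PstarMD D star"
begin

text \<open>
  This says that every nonzero finitely generated module is principal after localization at \<open>P\<close>,
  i.e. that \<open>D\<^sub>P\<close> is a valuation domain.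
\<close>

lemma QSpec_normalize:
  assumes P: "P \<in> QSpec D fstar" and p: "p \<noteq> 0"
  obtains z where "z \<noteq> 0" "smult z p \<in> polys_over D" "smult z p \<notin> polys_over P"
proof -
  note PD = QSpecD[OF P]
  let ?F = "cont p"
  have "\<exists>z. smult z p \<in> polys_over D \<and> smult z p \<notin> polys_over P"
  proof (rule ccontr)
    assume "\<not> ?thesis"
    then have all: "smult z p \<in> polys_over P" if "smult z p \<in> polys_over D" for z
      using that by blast
    \<comment> \<open>Otherwise the product of \<open>?F\<close> with its inverse would lie in
      \<open>P\<close>, whereas the PstarMD condition puts 1 into its closure.\<close>
    have "x * y \<in> P" if x: "x \<in> ?F" and y: "y \<in> module_inv D ?F" for x y
    proof -
      have "smult y p \<in> polys_over D"
        using y coeff_in_cont[of p] by (simp add: polys_over_def module_inv_def)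
      from all[OF this] have "p \<in> polys_over {x. y * x \<in> P}"
        by (simp add: polys_over_def)
      moreover have "is_submodule D {x. y * x \<in> P}"
        using PD(3) by (auto simp: submodule_D_iff distrib_left mult.left_commute[of y])
      ultimately have "?F \<subseteq> {x. y * x \<in> P}" by (simp add: cont_subset_iff)
      then show ?thesis using x by (auto simp: mult.commute)
    qed
    then have "module_prod D ?F (module_inv D ?F) \<subseteq> P"
      unfolding module_prod_def by (intro hull_minimal PD(3)) blast
    then have "fstar (module_prod D ?F (module_inv D ?F)) \<subseteq> fstar P"
      by (rule fstar_mono)
    moreover have "?F \<in> fg D" using p fg_iff by blast
    ultimately have "star D \<subseteq> fstar P"
      using PstarMD by (simp add: PstarMD_def)
    then have "1 \<in> fstar P" using star_extensive[OF D_Fbar] one_mem by blast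
    then show False using PD(5,7) one_mem by blast
  qed
  then obtain z where z: "smult z p \<in> polys_over D" "smult z p \<notin> polys_over P" by blast
  have "z \<noteq> 0"
  proof
    assume "z = 0"
    with z(2) PD(2) show False by (simp add: polys_over_def ideal_iff)
  qed
  with z show ?thesis by (rule that[rotated])
qed

text \<open>After localization at \<open>P\<close> the operation adds nothing to a finitely
  generated module. Normalize \<open>p\<close> together with \<open>x\<close>. A coefficient of
  \<open>smult z p\<close> outside \<open>P\<close> serves as \<open>t\<close>; if there is none,
  \<open>z * x\<close> falls into \<open>P\<close> as well, against the normalization.\<close>

lemma star_cont_local:
  assumes P: "P \<in> QSpec D fstar" and p: "p \<noteq> 0" and x: "x \<in> star (cont p)"
  obtains t where "t \<in> D" "t \<notin> P" "t * x \<in> cont p"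
proof -
  let ?q = "glue p [:x:]"
  obtain z where z: "z \<noteq> 0" "smult z ?q \<in> polys_over D" "smult z ?q \<notin> polys_over P"
    using QSpec_normalize[OF P, of ?q] glue_neq_0[of p "[:x:]"] p by blast
  have "range (coeff p) \<union> range (coeff [:x:]) \<subseteq> {y. z * y \<in> D}"
    using z(2) unfolding range_coeff_glue[symmetric] by (auto simp: polys_over_def)
  then have zD: "z * coeff p n \<in> D" "z * coeff [:x:] n \<in> D" for n by blast+
  have zx: "z * x \<in> D" using zD(2)[of 0] by simp
  show ?thesis
  proof (cases "\<exists>n. z * coeff p n \<notin> P")
    case True
    then obtain n where n: "z * coeff p n \<notin> P" by blast
    \<comment> \<open>Moving \<open>z\<close> from the coefficient to \<open>x\<close> exhibits
      \<open>t * x\<close> as a \<open>D\<close>-multiple of a coefficient of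
      \<open>p\<close>.\<close>
    have "(z * x) * coeff p n \<in> cont p"
      using submodule_cont[of p] zx coeff_in_cont[of p n] unfolding submodule_D_iff by blast
    then show ?thesis
      using n zD(1) by (intro that[of "z * coeff p n"]) (simp_all add: ac_simps)
  next
    case False
    then have zp: "smult z p \<in> polys_over P" by (simp add: polys_over_def)
    have "z * x \<in> star (cont (smult z p))"
      unfolding cont_smult[OF z(1)] star_scale[OF z(1) cont_Fbar[OF p]]
      using x by (rule imageI)
    then have "z * x \<in> P"
      using zp z(1) p zx by (intro QSpec_star_cont[OF P, of "smult z p"]) auto
    moreover have "0 \<in> P" using QSpecD(2)[OF P] by (simp add: ideal_iff)
    ultimately have "z * coeff [:x:] n \<in> P" for n
      by (cases n) simp_all
    with False have "range (coeff p) \<union> range (coeff [:x:]) \<subseteq> {y. z * y \<in> P}" by blast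
    then have "smult z ?q \<in> polys_over P"
      unfolding range_coeff_glue[symmetric] by (auto simp: polys_over_def)
    with z(3) show ?thesis by simp
  qed
qed

text \<open>Both \<open>smult z p\<close> and \<open>k\<close> are outside P[X], hence so is their
  product, and some \<open>z * coeff (p * k) m\<close> is outside \<open>P\<close>. This element is
  a denominator for every coefficient of \<open>p\<close>.\<close>

lemma gauss_local:
  assumes P: "P \<in> QSpec D fstar" and k: "k \<in> polys_over D" "k \<notin> polys_over P"
    and pk: "p * k \<in> polys_over D"
  shows "coeff p n \<in> localization D P"
proof (cases "p = 0")
  case True
  then have "coeff p n = 0 / 1" by simp
  moreover have "1 \<in> D - P" using QSpecD(5)[OF P] by simp
  ultimately show ?thesis unfolding localization_def using zero_mem by blast
next
  case False
  obtain z where z: "z \<noteq> 0" "smult z p \<in> polys_over D" "smult z p \<notin> polys_over P"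
    using QSpec_normalize[OF P False] by blast
  have "smult z p * k \<notin> polys_over P"
    using polys_over_prime[OF QSpecD(1)[OF P] z(2) k(1)] z(3) k(2) by blast
  then obtain m where m: "z * coeff (p * k) m \<notin> P"
    by (auto simp: polys_over_def)
  have "smult z p * k \<in> polys_over D" using z(2) k(1) by (rule polys_over_mult)
  then have mD: "z * coeff (p * k) m \<in> D" by (simp add: polys_over_def)
  have "coeff (p * k) m \<noteq> 0"
    using m QSpecD(2)[OF P] by (auto simp: ideal_iff)
  then have "coeff p n = (z * coeff p n * coeff (p * k) m) / (z * coeff (p * k) m)"
    using z(1) by simp
  moreover have "z * coeff p n * coeff (p * k) m \<in> D"
    using mult_mem[OF polys_over_coeff[OF z(2), of n] polys_over_coeff[OF pk, of m]] by simp
  ultimately show ?thesis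
    using m mD unfolding localization_def by blast
qed

end


section \<open>Extended ideals, their localizations and the maximal ideals of the Nagata
  ring\<close>

subsection \<open>Ideals of the Nagata ring\<close>

abbreviation pfrac :: "'k::field poly \<Rightarrow> 'k poly \<Rightarrow> 'k poly fract" where
  "pfrac \<equiv> Fraction_Field.Fract"

context semistar_domain
begin

abbreviation NaD :: "'k poly fract set" where
  "NaD \<equiv> Na D star"

lemma Na_eq: "NaD = {pfrac f g | f g. f \<in> polys_over D \<and> g \<in> denoms}"
  unfolding Na_def denoms_def mem_Collect_eq by metis

lemma denomsD: "g \<in> denoms \<Longrightarrow> g \<in> polys_over D" "g \<in> denoms \<Longrightarrow> g \<noteq> 0"
  by (simp_all add: denoms_iff)

lemma pfrac_NaI: "f \<in> polys_over D \<Longrightarrow> g \<in> denoms \<Longrightarrow> pfrac f g \<in> NaD"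
  unfolding Na_eq by blast

lemma field_subring_Na: "field_subring NaD"
proof
  show "1 \<in> NaD"
    using pfrac_NaI[OF polys_over_1 denoms_1] by (simp add: One_fract_def)
  fix x assume "x \<in> NaD"
  then obtain f g where x: "x = pfrac f g" "f \<in> polys_over D" "g \<in> denoms"
    unfolding Na_eq by blast
  show "- x \<in> NaD"
    using pfrac_NaI[OF polys_over_uminus[OF x(2)] x(3)] x(1) by simp
  fix y assume "y \<in> NaD"
  then obtain h k where y: "y = pfrac h k" "h \<in> polys_over D" "k \<in> denoms"
    unfolding Na_eq by blast
  show "x * y \<in> NaD"
    using pfrac_NaI[OF polys_over_mult[OF x(2) y(2)] denoms_mult[OF x(3) y(3)]] x(1) y(1) by simp
  have "f * k + h * g \<in> polys_over D"
    using x y denomsD by (intro polys_over_add polys_over_mult)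
  from pfrac_NaI[OF this denoms_mult[OF x(3) y(3)]] show "x + y \<in> NaD"
    using x y denomsD(2) by simp
qed

sublocale Na: field_subring NaD
  by (rule field_subring_Na)

lemma polys_over_const: "[:x:] \<in> polys_over D \<longleftrightarrow> x \<in> D"
  by (simp add: polys_over_pCons polys_over_0)

lemma poly_in_Na: "f \<in> polys_over D \<Longrightarrow> pfrac f 1 \<in> NaD"
  by (rule pfrac_NaI[OF _ denoms_1])

text \<open>The elements of \<open>denoms\<close> are units of the Nagata ring, so an ideal is
  determined by the polynomials it contains.\<close>

lemma pfrac_in_ideal_iff:
  assumes J: "ideal J (ring_on NaD)" and g: "g \<in> denoms"
  shows "pfrac f g \<in> J \<longleftrightarrow> pfrac f 1 \<in> J"
proof -
  have J_mult: "\<And>a x. a \<in> NaD \<Longrightarrow> x \<in> J \<Longrightarrow> a * x \<in> J"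
    using J by (simp add: Na.ideal_iff)
  have "pfrac g 1 * pfrac f g = pfrac f 1" "pfrac 1 g * pfrac f 1 = pfrac f g"
    using denomsD(2)[OF g] by (simp_all add: eq_fract)
  moreover have "pfrac g 1 \<in> NaD" "pfrac 1 g \<in> NaD"
    using g denomsD(1) by (auto intro: poly_in_Na pfrac_NaI polys_over_1)
  ultimately show ?thesis using J_mult by metis
qed

text \<open>Horner's scheme: the indeterminate belongs to the Nagata ring, so the polynomial can be
  rebuilt inside \<open>J\<close> from its constants.\<close>

lemma poly_in_ideal:
  assumes J: "ideal J (ring_on NaD)"
  shows "(\<And>n. pfrac [:coeff f n:] 1 \<in> J) \<Longrightarrow> pfrac f 1 \<in> J"
proof (induction f)
  case 0
  then show ?case using J by (simp add: Na.ideal_iff Zero_fract_def)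
next
  case (pCons a f)
  have "[:0, 1:] \<in> polys_over D" by (simp add: polys_over_pCons polys_over_0)
  then have X: "pfrac [:0, 1:] 1 \<in> NaD" by (rule poly_in_Na)
  have "pfrac [:a:] 1 \<in> J" using pCons.prems[of 0] by simp
  moreover have "pfrac f 1 \<in> J" using pCons.prems[of "Suc n" for n] by (intro pCons.IH) simp
  then have "pfrac [:0, 1:] 1 * pfrac f 1 \<in> J" using X J unfolding Na.ideal_iff by blast
  ultimately have "pfrac [:a:] 1 + pfrac [:0, 1:] 1 * pfrac f 1 \<in> J"
    using J unfolding Na.ideal_iff by blast
  then show ?case by simp
qed

text \<open>An explicit form of the extended ideal, better suited to testing membership than the
  generated ideal in \<open>Na_extension\<close>.\<close>

definition ext :: "'k set \<Rightarrow> 'k poly fract set" where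
  "ext P = {pfrac f g | f g. f \<in> polys_over P \<and> g \<in> denoms}"

lemma extI: "f \<in> polys_over P \<Longrightarrow> g \<in> denoms \<Longrightarrow> pfrac f g \<in> ext P"
  unfolding ext_def by blast

lemma extE:
  assumes "x \<in> ext P"
  obtains f g where "x = pfrac f g" "f \<in> polys_over P" "g \<in> denoms"
  using assms unfolding ext_def by blast

lemma ideal_ext:
  assumes P: "ideal P (ring_on D)"
  shows "ideal (ext P) (ring_on NaD)"
  unfolding Na.ideal_iff
proof (intro conjI ballI)
  have PD: "polys_over P \<subseteq> polys_over D"
    using P by (intro polys_over_mono) (simp add: ideal_iff)
  then show "ext P \<subseteq> NaD"
    by (blast elim: extE intro: pfrac_NaI)
  have "0 \<in> polys_over P" using P by (simp add: polys_over_def ideal_iff)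
  then show "0 \<in> ext P"
    unfolding Zero_fract_def using denoms_1 by (rule extI)
  fix y assume "y \<in> ext P"
  then obtain h k where y: "y = pfrac h k" "h \<in> polys_over P" "k \<in> denoms"
    by (rule extE)
  show "x * y \<in> ext P" if x: "x \<in> NaD" for x
  proof -
    obtain f g where x: "x = pfrac f g" "f \<in> polys_over D" "g \<in> denoms"
      using x unfolding Na_eq by blast
    have "x * y = pfrac (f * h) (g * k)" using x y by simp
    then show ?thesis
      using extI[OF polys_over_mult_ideal[OF P x(2) y(2)] denoms_mult[OF x(3) y(3)]] by simp
  qed
  fix x assume "x \<in> ext P"
  then obtain f g where x: "x = pfrac f g" "f \<in> polys_over P" "g \<in> denoms"
    by (rule extE)
  have "x + y = pfrac (k * f + g * h) (g * k)"
    using x y denomsD(2) by (simp add: mult.commute)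
  moreover have "k * f + g * h \<in> polys_over P"
    using x y denomsD(1) by (intro polys_over_add_ideal[OF P] polys_over_mult_ideal[OF P])
  ultimately show "x + y \<in> ext P"
    using extI[OF _ denoms_mult[OF x(3) y(3)]] by simp
qed

lemma const_in_extI: "x \<in> P \<Longrightarrow> 0 \<in> P \<Longrightarrow> pfrac [:x:] 1 \<in> ext P"
  by (rule extI[OF _ denoms_1]) (simp add: polys_over_def coeff_pCons split: nat.split)

lemma Na_extension_eq:
  assumes P: "ideal P (ring_on D)"
  shows "Na_extension D star P = ext P"
proof
  have "(\<lambda>p. pfrac [:p:] 1) ` P \<subseteq> ext P"
    using P const_in_extI unfolding ideal_iff by blast
  then show "Na_extension D star P \<subseteq> ext P"
    unfolding Na_extension_def genideal_def using ideal_ext[OF P] by blast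
  have "ext P \<subseteq> J" if J: "ideal J (ring_on NaD)" "(\<lambda>p. pfrac [:p:] 1) ` P \<subseteq> J" for J
  proof
    fix x assume "x \<in> ext P"
    then obtain f g where fg: "x = pfrac f g" "f \<in> polys_over P" "g \<in> denoms" by (rule extE)
    have "pfrac [:coeff f n:] 1 \<in> J" for n
      using J(2) polys_over_coeff[OF fg(2), of n] by blast
    from poly_in_ideal[OF J(1) this] show "x \<in> J"
      by (simp add: fg(1) pfrac_in_ideal_iff[OF J(1) fg(3)])
  qed
  then show "ext P \<subseteq> Na_extension D star P"
    unfolding Na_extension_def genideal_def by blast
qed

text \<open>Membership does not depend on the chosen fraction: if \<open>f / g = h / k\<close> with
  \<open>h\<close> in P[X], then \<open>f * k\<close> is in P[X], while the denominator
  \<open>k\<close> is outside this prime.\<close>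

lemma pfrac_in_ext_iff:
  assumes P: "P \<in> QSpec D fstar" and f: "f \<in> polys_over D" and g: "g \<in> denoms"
  shows "pfrac f g \<in> ext P \<longleftrightarrow> f \<in> polys_over P"
proof
  show "f \<in> polys_over P \<Longrightarrow> pfrac f g \<in> ext P"
    using g by (rule extI[rotated])
  assume "pfrac f g \<in> ext P"
  then obtain h k where hk: "pfrac f g = pfrac h k" "h \<in> polys_over P" "k \<in> denoms"
    by (rule extE)
  then have "f * k = g * h"
    using denomsD(2) g by (simp add: eq_fract mult.commute)
  then have "f * k \<in> polys_over P"
    using polys_over_mult_ideal[OF QSpecD(2)[OF P] denomsD(1)[OF g] hk(2)] by simp
  then show "f \<in> polys_over P"
    using polys_over_prime[OF QSpecD(1)[OF P] f denomsD(1)[OF hk(3)]]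
      denoms_not_polys_over[OF P hk(3)] by blast
qed

lemma const_in_ext_iff:
  assumes P: "P \<in> QSpec D fstar" and x: "x \<in> D"
  shows "pfrac [:x:] 1 \<in> ext P \<longleftrightarrow> x \<in> P"
proof -
  have "[:x:] \<in> polys_over P \<longleftrightarrow> x \<in> P"
    using QSpecD(2)[OF P]
    by (auto simp: polys_over_def ideal_iff coeff_pCons split: nat.split)
  then show ?thesis
    using pfrac_in_ext_iff[OF P _ denoms_1] x by (simp add: polys_over_const)
qed

lemma ext_subset_iff:
  assumes "P \<in> QSpec D fstar" "Q \<in> QSpec D fstar"
  shows "ext P \<subseteq> ext Q \<longleftrightarrow> P \<subseteq> Q"
proof
  assume sub: "ext P \<subseteq> ext Q"
  show "P \<subseteq> Q"
  proof
    fix x assume "x \<in> P"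
    moreover from this have "x \<in> D" using QSpecD(4)[OF assms(1)] by blast
    ultimately show "x \<in> Q"
      using sub const_in_ext_iff[OF assms(1)] const_in_ext_iff[OF assms(2)] by blast
  qed
next
  assume "P \<subseteq> Q"
  then show "ext P \<subseteq> ext Q"
    by (blast elim: extE intro: extI subsetD[OF polys_over_mono])
qed

lemma ext_neq_zero:
  assumes "P \<in> QSpec D fstar"
  shows "ext P \<noteq> {0}"
proof
  assume "ext P = {0}"
  have "P \<subseteq> {0}"
  proof
    fix x assume "x \<in> P"
    then have "pfrac [:x:] 1 \<in> ext P"
      using QSpecD(2)[OF assms] by (intro const_in_extI) (simp_all add: ideal_iff)
    then have "pfrac [:x:] 1 = pfrac 0 1"
      by (simp add: \<open>ext P = {0}\<close> Zero_fract_def)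
    then show "x \<in> {0}" by (simp add: eq_fract)
  qed
  moreover have "0 \<in> P" using QSpecD(2)[OF assms] by (simp add: ideal_iff)
  ultimately show False using QSpecD(6)[OF assms] by blast
qed

lemma primeideal_ext:
  assumes P: "P \<in> QSpec D fstar"
  shows "primeideal (ext P) (ring_on NaD)"
  unfolding Na.primeideal_iff
proof (intro conjI ballI impI)
  show id: "ideal (ext P) (ring_on NaD)" by (rule ideal_ext[OF QSpecD(2)[OF P]])
  have "1 \<notin> ext P"
    using const_in_ext_iff[OF P one_mem] QSpecD(5)[OF P] by (simp add: One_fract_def one_pCons)
  then show "ext P \<noteq> NaD" by (simp add: Na.proper_ideal_iff[OF id])
  fix x y assume "x \<in> NaD" "y \<in> NaD" and xy: "x * y \<in> ext P"
  then obtain f g h k where x: "x = pfrac f g" "f \<in> polys_over D" "g \<in> denoms"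
    and y: "y = pfrac h k" "h \<in> polys_over D" "k \<in> denoms"
    unfolding Na_eq by blast
  have "pfrac (f * h) (g * k) \<in> ext P" using xy x y by simp
  then have "f * h \<in> polys_over P"
    using pfrac_in_ext_iff[OF P polys_over_mult[OF x(2) y(2)] denoms_mult[OF x(3) y(3)]] by simp
  then have "f \<in> polys_over P \<or> h \<in> polys_over P"
    by (rule polys_over_prime[OF QSpecD(1)[OF P] x(2) y(2)])
  then show "x \<in> ext P \<or> y \<in> ext P"
    unfolding x(1) y(1) pfrac_in_ext_iff[OF P x(2,3)] pfrac_in_ext_iff[OF P y(2,3)] .
qed

text \<open>This is D[X] localized at P[X]: denominators of the Nagata ring avoid P[X] and are
  absorbed into the new ones.\<close>

lemma localization_ext:
  assumes P: "P \<in> QSpec D fstar"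
  shows "localization NaD (ext P) =
    {pfrac f g | f g. f \<in> polys_over D \<and> g \<in> polys_over D \<and> g \<notin> polys_over P}"
  (is "_ = ?R")
proof (intro equalityI subsetI)
  fix x assume "x \<in> localization NaD (ext P)"
  then obtain a s where x: "x = a / s" "a \<in> NaD" "s \<in> NaD" "s \<notin> ext P"
    unfolding localization_def by blast
  obtain f g where a: "a = pfrac f g" "f \<in> polys_over D" "g \<in> denoms"
    using x(2) unfolding Na_eq by blast
  obtain h k where s: "s = pfrac h k" "h \<in> polys_over D" "k \<in> denoms"
    using x(3) unfolding Na_eq by blast
  have "h \<notin> polys_over P"
    using x(4) pfrac_in_ext_iff[OF P s(2,3)] s(1) by simp
  then have "g * h \<notin> polys_over P"
    using polys_over_prime[OF QSpecD(1)[OF P] denomsD(1)[OF a(3)] s(2)]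
      denoms_not_polys_over[OF P a(3)] by blast
  moreover have "f * k \<in> polys_over D" "g * h \<in> polys_over D"
    using a s denomsD(1) by (auto intro: polys_over_mult)
  moreover have "x = pfrac (f * k) (g * h)" using x(1) a(1) s(1) by simp
  ultimately show "x \<in> ?R" by blast
next
  fix x assume "x \<in> ?R"
  then obtain f g where x: "x = pfrac f g" "f \<in> polys_over D" "g \<in> polys_over D"
    "g \<notin> polys_over P" by blast
  have "x = pfrac f 1 / pfrac g 1" using x(1) by simp
  moreover have "pfrac g 1 \<notin> ext P"
    using pfrac_in_ext_iff[OF P x(3) denoms_1] x(4) by simp
  ultimately show "x \<in> localization NaD (ext P)"
    unfolding localization_def using poly_in_Na[OF x(2)] poly_in_Na[OF x(3)] by blast
qed

text \<open>Given \<open>[:x:] * g = f\<close> with \<open>g\<close> outside P[X], comparing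
  coefficients at an index where \<open>g\<close> leaves \<open>P\<close> writes \<open>x\<close> as
  a fraction over \<open>D - P\<close>.\<close>

lemma const_in_localization_ext_iff:
  assumes P: "P \<in> QSpec D fstar"
  shows "pfrac [:x:] 1 \<in> localization NaD (ext P) \<longleftrightarrow> x \<in> localization D P"
proof
  note P0 = QSpecD(2)[OF P, unfolded ideal_iff, THEN conjunct2, THEN conjunct1]
  {
    assume "pfrac [:x:] 1 \<in> localization NaD (ext P)"
    then obtain f g where fg: "pfrac [:x:] 1 = pfrac f g" "f \<in> polys_over D" "g \<in> polys_over D"
      "g \<notin> polys_over P" unfolding localization_ext[OF P] by blast
    have "g \<noteq> 0" using fg(4) P0 by (auto simp: polys_over_def)
    then have eq: "[:x:] * g = f" using fg(1) by (simp add: eq_fract)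
    obtain n where n: "coeff g n \<notin> P" using fg(4) by (auto simp: polys_over_def)
    have "x * coeff g n = coeff f n" by (simp flip: eq)
    moreover have "coeff g n \<noteq> 0" using n P0 by metis
    ultimately have "x = coeff f n / coeff g n" by (simp add: field_simps)
    then show "x \<in> localization D P"
      unfolding localization_def
      using n polys_over_coeff[OF fg(2)] polys_over_coeff[OF fg(3)] by blast
  }
  assume "x \<in> localization D P"
  then obtain a s where x: "x = a / s" "a \<in> D" "s \<in> D" "s \<notin> P"
    unfolding localization_def by blast
  have "s \<noteq> 0" using x(4) P0 by metis
  then have "pfrac [:x:] 1 = pfrac [:a:] [:s:]" using x(1) by (simp add: eq_fract)
  moreover have "[:s:] \<notin> polys_over P"
    using polys_over_coeff[of "[:s:]" P 0] x(4) by auto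
  ultimately show "pfrac [:x:] 1 \<in> localization NaD (ext P)"
    unfolding localization_ext[OF P] using x(2,3) polys_over_const by blast
qed

text \<open>The polynomials in \<open>J\<close> are closed under gluing and contain no denominator,
  since that would be a unit; \<open>glue_closed_subset_QMax\<close> puts them into one
  M[X].\<close>

lemma ideal_subset_ext:
  assumes J: "ideal J (ring_on NaD)" "J \<noteq> NaD" "J \<noteq> {0}"
  obtains M where "M \<in> QMax D fstar" "J \<subseteq> ext M"
proof -
  have J0: "0 \<in> J" and J_sub: "J \<subseteq> NaD" and J_add: "\<And>x y. x \<in> J \<Longrightarrow> y \<in> J \<Longrightarrow> x + y \<in> J"
    and J_mult: "\<And>a x. a \<in> NaD \<Longrightarrow> x \<in> J \<Longrightarrow> a * x \<in> J"
    using J(1) by (simp_all add: Na.ideal_iff)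
  let ?I = "{f \<in> polys_over D. pfrac f 1 \<in> J}"
  obtain y where y: "y \<in> J" "y \<noteq> 0" using J(3) J0 by blast
  obtain h k where hk: "y = pfrac h k" "h \<in> polys_over D" "k \<in> denoms"
    using y(1) J_sub unfolding Na_eq by blast
  have h: "h \<in> ?I" using pfrac_in_ideal_iff[OF J(1) hk(3)] y(1) hk by simp
  have h0: "h \<noteq> 0"
    using y(2) hk(1) denomsD(2)[OF hk(3)] by (auto simp: Zero_fract_def eq_fract)
  have glue: "glue f g \<in> ?I" if f: "f \<in> ?I" and g: "g \<in> ?I" for f g
  proof -
    let ?m = "monom 1 (Suc (degree f)) :: 'k poly"
    have "?m \<in> polys_over D" by (simp add: polys_over_def)
    from J_mult[OF poly_in_Na[OF this], of "pfrac g 1"]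
    have "pfrac ?m 1 * pfrac g 1 \<in> J" using g by blast
    from J_add[OF _ this, of "pfrac f 1"]
    have "pfrac f 1 + pfrac ?m 1 * pfrac g 1 \<in> J" using f by blast
    then have "pfrac (glue f g) 1 \<in> J" by (simp add: glue_def)
    moreover have "glue f g \<in> polys_over D" using f g by (simp add: polys_over_glue)
    ultimately show ?thesis by simp
  qed
  have disj: "?I \<inter> denoms = {}"
  proof (rule ccontr)
    assume "?I \<inter> denoms \<noteq> {}"
    then obtain g where g: "g \<in> denoms" "pfrac g 1 \<in> J" by blast
    then have "pfrac g g \<in> J" using pfrac_in_ideal_iff[OF J(1) g(1)] by simp
    moreover have "pfrac g g = 1"
      using denomsD(2)[OF g(1)] by (simp add: One_fract_def eq_fract)
    ultimately show False using J(2) Na.proper_ideal_iff[OF J(1)] by simp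
  qed
  have sub: "?I \<subseteq> polys_over D" by blast
  obtain M where M: "M \<in> QMax D fstar" "?I \<subseteq> polys_over M"
    using sub glue h h0 disj by (rule glue_closed_subset_QMax)
  have "J \<subseteq> ext M"
  proof
    fix x assume x: "x \<in> J"
    then obtain f g where fg: "x = pfrac f g" "f \<in> polys_over D" "g \<in> denoms"
      using J_sub unfolding Na_eq by blast
    then have "f \<in> ?I" using pfrac_in_ideal_iff[OF J(1) fg(3)] x by simp
    then have "f \<in> polys_over M" using M(2) by blast
    then show "x \<in> ext M" using extI fg(1,3) by simp
  qed
  with M(1) show ?thesis by (rule that)
qed

lemma QMax_QSpec: "M \<in> QMax D fstar \<Longrightarrow> M \<in> QSpec D fstar"
  using QMax_subset_QSpec by (rule subsetD)

text \<open>A proper ideal above \<open>ext M\<close> lies in some \<open>ext M'\<close>; then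
  \<open>M \<subseteq> M'\<close>, and maximality of \<open>M\<close> closes the circle.\<close>

lemma maximalideal_ext:
  assumes M: "M \<in> QMax D fstar"
  shows "maximalideal (ext M) (ring_on NaD)"
  unfolding Na.maximalideal_iff
proof (intro conjI allI impI)
  show "ideal (ext M) (ring_on NaD)" and "ext M \<noteq> NaD"
    using primeideal_ext[OF QMax_QSpec[OF M]] by (simp_all add: Na.primeideal_iff)
  fix J assume J: "ideal J (ring_on NaD) \<and> ext M \<subseteq> J \<and> J \<noteq> NaD"
  have "0 \<in> ext M"
    using \<open>ideal (ext M) (ring_on NaD)\<close> by (simp add: Na.ideal_iff)
  then have "J \<noteq> {0}"
    using J ext_neq_zero[OF QMax_QSpec[OF M]] by blast
  then obtain M' where M': "M' \<in> QMax D fstar" "J \<subseteq> ext M'"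
    using J ideal_subset_ext[of J] by metis
  then have "ext M \<subseteq> ext M'" using J by blast
  then have "M \<subseteq> M'" by (simp add: ext_subset_iff QMax_QSpec M M'(1))
  then have "M' = M" using M M'(1) by (simp add: QMax_def)
  then show "J = ext M" using J M'(2) by blast
qed

lemma maximalideal_Na_iff:
  "maximalideal N (ring_on NaD) \<and> N \<noteq> {0} \<longleftrightarrow> (\<exists>M\<in>QMax D fstar. N = ext M)"
proof
  assume N: "maximalideal N (ring_on NaD) \<and> N \<noteq> {0}"
  then have id: "ideal N (ring_on NaD)" "N \<noteq> NaD" "N \<noteq> {0}"
    by (simp_all add: Na.maximalideal_iff)
  obtain M where M: "M \<in> QMax D fstar" "N \<subseteq> ext M"
    using id by (rule ideal_subset_ext)
  have "ideal (ext M) (ring_on NaD)" "ext M \<noteq> NaD"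
    using primeideal_ext[OF QMax_QSpec[OF M(1)]] by (simp_all add: Na.primeideal_iff)
  then have "ext M = N" using N M(2) by (simp add: Na.maximalideal_iff)
  then show "\<exists>M\<in>QMax D fstar. N = ext M" using M(1) by blast
next
  assume "\<exists>M\<in>QMax D fstar. N = ext M"
  then show "maximalideal N (ring_on NaD) \<and> N \<noteq> {0}"
    using maximalideal_ext ext_neq_zero QMax_QSpec by blast
qed

end


section \<open>The nonzero prime ideals of the Nagata ring of a PstarMD\<close>

context pstar_md
begin

lemma primeideal_Na_iff:
  "primeideal Q (ring_on NaD) \<and> Q \<noteq> {0} \<longleftrightarrow> (\<exists>P\<in>QSpec D fstar. Q = ext P)"
proof
  assume "primeideal Q (ring_on NaD) \<and> Q \<noteq> {0}"
  then have Q: "ideal Q (ring_on NaD)" "Q \<noteq> NaD" "Q \<noteq> {0}"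
    and Q_prime: "\<And>a b. a \<in> NaD \<Longrightarrow> b \<in> NaD \<Longrightarrow> a * b \<in> Q \<Longrightarrow> a \<in> Q \<or> b \<in> Q"
    by (simp_all add: Na.primeideal_iff)
  have Q0: "0 \<in> Q" and Q_sub: "Q \<subseteq> NaD" and Q_add: "\<And>x y. x \<in> Q \<Longrightarrow> y \<in> Q \<Longrightarrow> x + y \<in> Q"
    and Q_mult: "\<And>a x. a \<in> NaD \<Longrightarrow> x \<in> Q \<Longrightarrow> a * x \<in> Q"
    using Q(1) by (simp_all add: Na.ideal_iff)
  obtain M where M: "M \<in> QMax D fstar" "Q \<subseteq> ext M"
    using Q by (rule ideal_subset_ext)
  have MS: "M \<in> QSpec D fstar" by (rule QMax_QSpec[OF M(1)])
  let ?c = "\<lambda>x. pfrac [:x:] 1"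
  \<comment> \<open>The contraction of \<open>Q\<close> to \<open>D\<close>. That it is a
    quasi-ideal is not known yet, so normalization is done at \<open>M\<close>, which contains
    it.\<close>
  define P where "P = {x \<in> D. ?c x \<in> Q}"
  have P_iff: "x \<in> P \<longleftrightarrow> x \<in> D \<and> ?c x \<in> Q" for x
    unfolding P_def by (rule mem_Collect_eq)
  have c_Na: "?c x \<in> NaD" if "x \<in> D" for x
    using that by (intro poly_in_Na) (simp add: polys_over_const)
  have PM: "P \<subseteq> M"
  proof
    fix x assume "x \<in> P"
    then have "x \<in> D" "?c x \<in> ext M" using M(2) by (auto simp: P_iff)
    then show "x \<in> M" by (simp add: const_in_ext_iff[OF MS])
  qed
  have poly_Q: "pfrac f 1 \<in> Q \<longleftrightarrow> f \<in> polys_over P" if f: "f \<in> polys_over D" for f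
  proof
    assume "f \<in> polys_over P"
    from polys_over_coeff[OF this] have "?c (coeff f n) \<in> Q" for n by (simp add: P_iff)
    then show "pfrac f 1 \<in> Q" by (rule poly_in_ideal[OF Q(1)])
  next
    assume fQ: "pfrac f 1 \<in> Q"
    show "f \<in> polys_over P"
    proof (cases "f = 0")
      case True
      then show ?thesis using Q0 by (simp add: polys_over_def P_iff Zero_fract_def)
    next
      case False
      obtain z where z: "smult z f \<in> polys_over D" "smult z f \<notin> polys_over M"
        using QSpec_normalize[OF MS False] by metis
      have nQ: "pfrac (smult z f) 1 \<notin> Q"
        using M(2) pfrac_in_ext_iff[OF MS z(1) denoms_1] z(2) by blast
      have "coeff f n \<in> P" for n
      proof -
        have "?c (z * coeff f n) * pfrac f 1 \<in> Q"
          using Q_mult[OF c_Na fQ, of "z * coeff f n"] polys_over_coeff[OF z(1), of n]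
          by (simp only: coeff_smult)
        \<comment> \<open>Moving \<open>z\<close> to the other factor gives a product in
          \<open>Q\<close> whose second factor is outside \<open>Q\<close>; primality then puts the
          coefficient into \<open>Q\<close>.\<close>
        moreover have "?c (z * coeff f n) * pfrac f 1 = ?c (coeff f n) * pfrac (smult z f) 1"
          by (simp add: mult.commute)
        ultimately have "?c (coeff f n) * pfrac (smult z f) 1 \<in> Q" by (simp only:)
        then have "?c (coeff f n) \<in> Q"
          using Q_prime[OF c_Na[OF polys_over_coeff[OF f]] poly_in_Na[OF z(1)]] nQ by blast
        then show ?thesis using polys_over_coeff[OF f] unfolding P_iff by (intro conjI)
      qed
      then show ?thesis by (simp add: polys_over_def)
    qed
  qed
  have "Q = ext P"
  proof (intro equalityI subsetI)
    fix x assume x: "x \<in> Q"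
    then obtain f g where fg: "x = pfrac f g" "f \<in> polys_over D" "g \<in> denoms"
      using Q_sub unfolding Na_eq by blast
    then have "f \<in> polys_over P"
      using x pfrac_in_ideal_iff[OF Q(1) fg(3)] poly_Q[OF fg(2)] by simp
    then show "x \<in> ext P" using extI fg(1,3) by simp
  next
    fix x assume "x \<in> ext P"
    then obtain f g where fg: "x = pfrac f g" "f \<in> polys_over P" "g \<in> denoms"
      by (rule extE)
    have "P \<subseteq> D" unfolding P_def by (rule Collect_restrict)
    then have "f \<in> polys_over D" using fg(2) polys_over_mono by blast
    then show "x \<in> Q"
      using fg pfrac_in_ideal_iff[OF Q(1) fg(3)] poly_Q by simp
  qed
  have P_id: "ideal P (ring_on D)"
    unfolding ideal_iff
  proof (intro conjI ballI)
    show "P \<subseteq> D" unfolding P_def by (rule Collect_restrict)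
    show "0 \<in> P" using Q0 by (simp add: P_iff Zero_fract_def)
    fix y assume y: "y \<in> P"
    show "x + y \<in> P" if "x \<in> P" for x
      using that y Q_add[of "?c x" "?c y"] by (simp add: P_iff add_mem)
    show "a * y \<in> P" if "a \<in> D" for a
      using that y Q_mult[OF c_Na[OF that], of "?c y"] by (simp add: P_iff mult_mem mult.commute)
  qed
  have P_prime: "a \<in> P \<or> b \<in> P" if "a \<in> D" "b \<in> D" "a * b \<in> P" for a b
  proof -
    have "?c a * ?c b \<in> Q" using that(3) by (simp add: P_iff mult.commute)
    from Q_prime[OF c_Na[OF that(1)] c_Na[OF that(2)] this] show ?thesis
      using that by (simp add: P_iff)
  qed
  have "1 \<notin> P"
    using Q(2) Na.proper_ideal_iff[OF Q(1)] by (simp add: P_iff One_fract_def one_pCons)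
  then have "P \<noteq> D" by (simp add: proper_ideal_iff[OF P_id])
  then have prime: "primeideal P (ring_on D)"
    using P_id P_prime by (simp add: primeideal_iff)
  have "P \<noteq> {0}"
  proof
    assume "P = {0}"
    then have "f = 0" if "f \<in> polys_over P" for f
      using that by (simp add: polys_over_def poly_eq_iff)
    \<comment> \<open>For \<open>g = 0\<close> this is the default value of a fraction with zero
      denominator.\<close>
    moreover have "pfrac 0 g = 0" for g
      by (cases "g = 0") (simp_all add: Zero_fract_def eq_fract)
    ultimately have "Q \<subseteq> {0}" unfolding \<open>Q = ext P\<close> by (auto elim!: extE)
    with Q0 Q(3) show False by blast
  qed
  moreover have "fstar P \<inter> D = P"
  proof
    show "P \<subseteq> fstar P \<inter> D"
      using fstar_extensive[OF ideal_Fbar[OF P_id \<open>P \<noteq> {0}\<close>]] P_id by (simp add: ideal_iff)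
    show "fstar P \<inter> D \<subseteq> P"
    proof
      fix x assume x: "x \<in> fstar P \<inter> D"
      have subP: "is_submodule D P" using P_id by (simp add: ideal_submodule)
      obtain p where p: "p \<noteq> 0" "p \<in> polys_over P" "x \<in> star (cont p)"
        using x unfolding Int_iff mem_fstar_iff[OF subP] by blast
      \<comment> \<open>As \<open>P \<subseteq> M\<close>, this \<open>t\<close> is outside
        \<open>P\<close> too, and primality of \<open>P\<close> removes it from
        \<open>t * x\<close>.\<close>
      obtain t where t: "t \<in> D" "t \<notin> M" "t * x \<in> cont p"
        using MS p(1,3) by (rule star_cont_local)
      have "t * x \<in> P" using t(3) p(2) cont_subset_iff[OF subP] by blast
      then show "x \<in> P" using P_prime[OF t(1)] x t(2) PM by blast
    qed
  qed
  ultimately have "P \<in> QSpec D fstar"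
    using prime P_id by (simp add: QSpec_def quasi_star_ideal_def)
  with \<open>Q = ext P\<close> show "\<exists>P\<in>QSpec D fstar. Q = ext P" by blast
next
  assume "\<exists>P\<in>QSpec D fstar. Q = ext P"
  then show "primeideal Q (ring_on NaD) \<and> Q \<noteq> {0}"
    using primeideal_ext ext_neq_zero by blast
qed


section \<open>Transfer of sharpness between \<open>D\<close> and the Nagata ring\<close>

subsection \<open>Sharpness\<close>

lemma common_denominator:
  assumes P: "P \<in> QSpec D fstar" and q: "\<And>n. coeff q n \<in> localization D P"
  shows "\<exists>t\<in>D - P. smult t q \<in> polys_over D"
  using q
proof (induction q)
  case 0
  show ?case using QSpecD(5)[OF P] by (intro bexI[of _ 1]) (simp_all add: polys_over_0)
next
  case (pCons a q)
  have "coeff q n \<in> localization D P" for n using pCons.prems[of "Suc n"] by simp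
  then obtain t where t: "t \<in> D - P" "smult t q \<in> polys_over D" using pCons.IH by blast
  have "a \<in> localization D P" using pCons.prems[of 0] by simp
  then obtain b s where b: "a = b / s" "b \<in> D" "s \<in> D - P"
    unfolding localization_def by blast
  have "s \<noteq> 0" using b(3) QSpecD(2)[OF P] unfolding ideal_iff by blast
  then have "s * t * a = t * b" using b(1) by simp
  then have "s * t * a \<in> D" using t b by (simp only: mult_mem DiffD1)
  moreover have "smult (s * t) q \<in> polys_over D"
    using polys_over_mult[of "[:s:]" "smult t q"] b(3) t(2)
    by (simp add: polys_over_const mult.commute)
  ultimately have "smult (s * t) (pCons a q) \<in> polys_over D"
    by (simp add: polys_over_pCons)
  moreover have "s * t \<in> D - P"
    using b(3) t(1) QSpecD(1)[OF P] unfolding primeideal_iff by (simp add: mult_mem) blast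
  ultimately show ?case by blast
qed

lemma mem_Inter_setcompr:
  "x \<in> \<Inter>{f M | M. M \<in> S \<and> Q M} \<longleftrightarrow> (\<forall>M\<in>S. Q M \<longrightarrow> x \<in> f M)"
  by blast

lemma star_sharp_prime_iff:
  "star_sharp_prime D fstar P \<longleftrightarrow>
    (\<exists>x. (\<forall>M\<in>QMax D fstar. \<not> P \<subseteq> M \<longrightarrow> x \<in> localization D M) \<and> x \<notin> localization D P)"
proof -
  have "quotient_field D = UNIV" using domain_D by (simp add: domain_with_quotient_field_def)
  then show ?thesis
    unfolding star_sharp_prime_def Theta_def nabla_def mem_Collect_eq
    by (simp only: subset_iff Int_iff mem_Inter_setcompr UNIV_I simp_thms not_all not_imp)
qed

text \<open>Sharpness ranges over all maximal ideals, but the zero ideal is not among them: it lies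
  strictly below the proper ideal \<open>ext P\<close>. So only the ideals \<open>ext M\<close>
  occur.\<close>

lemma sharp_prime_Na_iff:
  assumes P: "P \<in> QSpec D fstar"
  shows "sharp_prime NaD (ext P) \<longleftrightarrow>
    (\<exists>y\<in>quotient_field NaD. (\<forall>M\<in>QMax D fstar. \<not> P \<subseteq> M \<longrightarrow> y \<in> localization NaD (ext M)) \<and>
       y \<notin> localization NaD (ext P))"
proof -
  have "N \<noteq> {0}" if "maximalideal N (ring_on NaD)" for N
  proof
    assume "N = {0}"
    then have "ext P = N"
      using that primeideal_ext[OF P] by (auto simp: Na.maximalideal_iff Na.primeideal_iff Na.ideal_iff)
    with \<open>N = {0}\<close> ext_neq_zero[OF P] show False by simp
  qed
  then have "maximalideal N (ring_on NaD) \<and> \<not> ext P \<subseteq> N \<longleftrightarrow>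
      (\<exists>M\<in>QMax D fstar. N = ext M \<and> \<not> P \<subseteq> M)" for N
    using maximalideal_Na_iff[of N] ext_subset_iff[OF P QMax_QSpec] by metis
  then have "{localization NaD N | N. maximalideal N (ring_on NaD) \<and> \<not> ext P \<subseteq> N} =
      {localization NaD (ext M) | M. M \<in> QMax D fstar \<and> \<not> P \<subseteq> M}"
    by (simp only:) blast
  then show ?thesis
    unfolding sharp_prime_def
    by (simp only: subset_iff Int_iff mem_Inter_setcompr not_all not_imp Bex_def conj_assoc)
qed

text \<open>From \<open>D\<close> to the Nagata ring the witness is kept as a constant. Conversely,
  it is a coefficient of the numerator once the denominator is normalized at
  \<open>P\<close>.\<close>

lemma sharp_iff:
  assumes P: "P \<in> QSpec D fstar"
  shows "star_sharp_prime D fstar P \<longleftrightarrow> sharp_prime NaD (ext P)"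
  unfolding star_sharp_prime_iff sharp_prime_Na_iff[OF P]
proof
  assume "\<exists>x. (\<forall>M\<in>QMax D fstar. \<not> P \<subseteq> M \<longrightarrow> x \<in> localization D M) \<and> x \<notin> localization D P"
  then obtain x where x: "\<And>M. M \<in> QMax D fstar \<Longrightarrow> \<not> P \<subseteq> M \<Longrightarrow> x \<in> localization D M"
    "x \<notin> localization D P" by blast
  have "x \<in> quotient_field D" using domain_D by (simp add: domain_with_quotient_field_def)
  then obtain a b where ab: "x = a / b" "a \<in> D" "b \<in> D" "b \<noteq> 0"
    unfolding quotient_field_def by blast
  have "pfrac [:x:] 1 = pfrac [:a:] 1 / pfrac [:b:] 1"
    using ab by (simp add: eq_fract)
  moreover have "pfrac [:b:] 1 \<noteq> 0" using ab(4) by (simp add: Zero_fract_def eq_fract)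
  moreover have "pfrac [:a:] 1 \<in> NaD" "pfrac [:b:] 1 \<in> NaD"
    using ab by (simp_all add: poly_in_Na polys_over_const)
  ultimately have "pfrac [:x:] 1 \<in> quotient_field NaD"
    unfolding quotient_field_def by blast
  then show "\<exists>y\<in>quotient_field NaD.
      (\<forall>M\<in>QMax D fstar. \<not> P \<subseteq> M \<longrightarrow> y \<in> localization NaD (ext M)) \<and>
      y \<notin> localization NaD (ext P)"
    using x const_in_localization_ext_iff P QMax_QSpec by blast
next
  assume "\<exists>y\<in>quotient_field NaD.
      (\<forall>M\<in>QMax D fstar. \<not> P \<subseteq> M \<longrightarrow> y \<in> localization NaD (ext M)) \<and>
      y \<notin> localization NaD (ext P)"
  then obtain y where y: "\<And>M. M \<in> QMax D fstar \<Longrightarrow> \<not> P \<subseteq> M \<Longrightarrow> y \<in> localization NaD (ext M)"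
    "y \<notin> localization NaD (ext P)" by blast
  obtain f g where fg: "y = pfrac f g" "g \<noteq> 0" by (cases y) auto
  obtain z where z: "z \<noteq> 0" "smult z g \<in> polys_over D" "smult z g \<notin> polys_over P"
    using P fg(2) by (rule QSpec_normalize)
  \<comment> \<open>If all these coefficients were in D_P, a common denominator \<open>t\<close>
    outside \<open>P\<close> would exhibit \<open>y\<close> as a fraction over D[X] with denominator
    outside P[X].\<close>
  have "\<exists>n. coeff (smult z f) n \<notin> localization D P"
  proof (rule ccontr)
    assume "\<not> ?thesis"
    then obtain t where t: "t \<in> D - P" "smult t (smult z f) \<in> polys_over D"
      using common_denominator[OF P, of "smult z f"] by blast
    have tP: "[:t:] \<in> polys_over D" "[:t:] \<notin> polys_over P"
      using t(1) polys_over_coeff[of "[:t:]" P 0] by (auto simp: polys_over_const)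
    have "[:t:] * smult z g \<in> polys_over D" "[:t:] * smult z g \<notin> polys_over P"
      using polys_over_mult[OF tP(1) z(2)] polys_over_prime[OF QSpecD(1)[OF P] tP(1) z(2)] tP z
      by blast+
    moreover have "t \<noteq> 0"
      using t(1) QSpecD(2)[OF P] unfolding ideal_iff by blast
    then have "y = pfrac (smult t (smult z f)) ([:t:] * smult z g)"
      using fg z(1) by (simp add: eq_fract mult.commute)
    ultimately have "y \<in> localization NaD (ext P)"
      unfolding localization_ext[OF P] using t(2) by blast
    with y(2) show False by contradiction
  qed
  then obtain n where n: "coeff (smult z f) n \<notin> localization D P" by blast
  have "coeff (smult z f) n \<in> localization D M" if M: "M \<in> QMax D fstar" "\<not> P \<subseteq> M" for M
  proof -
    have MS: "M \<in> QSpec D fstar" by (rule QMax_QSpec[OF M(1)])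
    obtain h k where hk: "y = pfrac h k" "h \<in> polys_over D" "k \<in> polys_over D" "k \<notin> polys_over M"
      using y(1)[OF M] unfolding localization_ext[OF MS] by blast
    have "k \<noteq> 0" using hk(4) QSpecD(2)[OF MS] by (auto simp: polys_over_def ideal_iff)
    then have "f * k = h * g" using hk(1) fg by (simp add: eq_fract)
    \<comment> \<open>The right side is a product of polynomials over \<open>D\<close>, which is the
      integrality that \<open>gauss_local\<close> asks of the left side.\<close>
    then have "smult z f * k = smult z g * h" by (simp add: mult.commute)
    then have "smult z f * k \<in> polys_over D"
      using polys_over_mult[OF z(2) hk(2)] by simp
    with hk(3,4) show ?thesis by (rule gauss_local[OF MS])
  qed
  with n show "\<exists>x. (\<forall>M\<in>QMax D fstar. \<not> P \<subseteq> M \<longrightarrow> x \<in> localization D M) \<and>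
      x \<notin> localization D P" by blast
qed

end

theorem proposition3p5:
  fixes D :: "'k::field set" and star :: "'k set \<Rightarrow> 'k set"
  assumes "domain_with_quotient_field D"
    and "semistar_operation D star"
    and "PstarMD D star"
  shows "(\<forall>P\<in>QSpec D (finite_type D star).
            star_sharp_prime D (finite_type D star) P \<longleftrightarrow>
            sharp_prime (Na D star) (Na_extension D star P)) \<and>
         (star_sharp D (finite_type D star) \<longleftrightarrow> sharp (Na D star)) \<and>
         (star_doublesharp D (finite_type D star) \<longleftrightarrow> doublesharp (Na D star))"
proof -
  interpret pstar_md D star
    by unfold_locales (rule assms)+
  have "star_sharp D fstar \<longleftrightarrow> sharp NaD"
    unfolding star_sharp_def sharp_def maximalideal_Na_iff
    using sharp_iff QMax_QSpec by metis
  moreover have "star_doublesharp D fstar \<longleftrightarrow> doublesharp NaD"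
    unfolding star_doublesharp_def doublesharp_def primeideal_Na_iff
    using sharp_iff by metis
  moreover have "star_sharp_prime D fstar P \<longleftrightarrow> sharp_prime NaD (Na_extension D star P)"
    if "P \<in> QSpec D fstar" for P
    using sharp_iff[OF that] Na_extension_eq[OF QSpecD(2)[OF that]] by simp
  ultimately show ?thesis by blast
qed

end
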